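(* Let $k \geq 4$ be an integer. For each natural number $N$, let $F_k(N)$ denote the largest cardinality of a subset $A \subseteq \{1,\dots,N\}$ such that there do not exist $k$ distinct elements of $A$ whose product is a perfect square. Then there exists a constant $c_k>0$ such that $F_k(N) \leq (1-c_k+o(1))N$ as $N \to \infty$; equivalently, $\limsup_{N\to\infty} F_k(N)/N < 1$.
   Context: The natural numbers start from $1$. The notation $o(1)$ denotes a quantity tending to $0$ as $N\to\infty$ with $k$ held fixed. *)

theory Defs
  imports
    Complex_Main
    "HOL-Library.Extended_Real"
    "HOL-Computational_Algebra.Nth_Powers"
begin

definition square_product_free :: "nat \<Rightarrow> nat set \<Rightarrow> bool" where
  "square_product_free k A \<longleftrightarrow> \<not> (\<exists>S\<subseteq>A. finite S \<and> card S = k \<and> is_square (\<Prod>S))"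

definition max_square_product_free :: "nat \<Rightarrow> nat \<Rightarrow> nat" where
  "max_square_product_free k N = Max {card A |A. A \<subseteq> {1..N} \<and> square_product_free k A}"

(* Max is only meaningful on finite nonempty sets; for k > 0 this is such a set. *)
lemma max_square_product_free_wf:
  assumes "k > 0"
  shows "finite {card A |A. A \<subseteq> {1..N} \<and> square_product_free k A}"
    and "{card A |A. A \<subseteq> {1..N} \<and> square_product_free k A} \<noteq> {}"
proof -
  have "finite (card ` Pow {1..N})" by simp
  then show "finite {card A |A. A \<subseteq> {1..N} \<and> square_product_free k A}"
    by (rule rev_finite_subset) auto
  have "square_product_free k {}"
    using assms by (auto simp: square_product_free_def)
  then show "{card A |A. A \<subseteq> {1..N} \<and> square_product_free k A} \<noteq> {}"
    by blast
qed

end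

theory Submission
  imports Defs "HOL-Computational_Algebra.Squarefree" "HOL-Library.FuncSet"
begin

text \<open>
  A set \<open>A\<close> missing few elements of \<open>{1..N}\<close> contains a whole configuration of \<open>k\<close> numbers with square
  product as soon as there is a random such configuration each of whose members has density
  \<open>O(1 / N)\<close> on \<open>{1..N}\<close>. Adding a pair \<open>x, 4 * x\<close> preserves squareness of the product, so only
  \<open>k = 5\<close> needs work.

  For \<open>k = 5\<close> write each number as a smooth part times a few large primes. The smooth parts are
  \<open>u, u, x * y, y * z, z * x\<close>, where primes \<open>p\<close> enter \<open>u\<close> with weight \<open>1 / p\<close> and enter \<open>x, y, z\<close> with weight
  \<open>1 / (2 * p)\<close>; then each of the five has about the distribution of the smooth part of a random
  integer. The large primes sit on the edges of a graph on the five numbers, and every number is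
  multiplied by the primes on its edges. All five products must have size about \<open>N\<close>. Because the
  graph stays connected and not bipartite after deletion of any vertex, prescribing one of the five
  numbers leaves the other four size constraints independent, so that the number has
  no more mass than its fair share. The cycle on three vertices alone does not have this property,
  which is the multiplication table obstruction for \<open>k = 3\<close>.
\<close>

section \<open>Chebyshev bounds\<close>

lemma sum_UNION_le:
  fixes f :: "'a \<Rightarrow> real"
  assumes "finite I" "\<And>i. i \<in> I \<Longrightarrow> finite (A i)" "\<And>x. 0 \<le> f x"
  shows "sum f (\<Union>i\<in>I. A i) \<le> (\<Sum>i\<in>I. sum f (A i))"
  using assms(1,2)
proof (induction I rule: finite_induct)
  case (insert i I)
  have "sum f (A i \<union> (\<Union>i\<in>I. A i)) = sum f (A i) + sum f (\<Union>i\<in>I. A i) - sum f (A i \<inter> (\<Union>i\<in>I. A i))"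
    using insert by (intro sum_Un) auto
  also have "\<dots> \<le> sum f (A i) + sum f (\<Union>i\<in>I. A i)"
    using assms(3) by (simp add: sum_nonneg)
  finally show ?case using insert by auto
qed auto

lemma prod_primes_dvd:
  fixes n :: nat
  assumes "finite S" "\<And>p. p \<in> S \<Longrightarrow> prime p \<and> p dvd n"
  shows "\<Prod>S dvd n"
  using assms
proof (induction S rule: finite_induct)
  case (insert p S)
  have "coprime p (\<Prod>S)"
    using insert by (intro prod_coprime_right) (metis insertCI primes_coprime)
  with insert show ?case by (simp add: divides_mult)
qed auto

lemma finite_primes_bounded [simp]: "finite {p::nat. prime p \<and> l < p \<and> p \<le> u}"
  by (rule finite_subset[of _ "{..u}"]) auto

text \<open>Erdos's argument: with \<open>n = 2 ^ j\<close>, every prime in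
  \<open>(n, 2 * n]\<close> divides the central binomial coefficient
  \<open>(2 * n) choose n\<close>, which is at most \<open>2 ^ (2 * n)\<close>. Each of these primes
  exceeds \<open>2 ^ j\<close>, so comparing exponents of 2 bounds their number.\<close>

lemma card_primes_dyadic:
  "j * card {p::nat. prime p \<and> 2^j < p \<and> p \<le> 2^(j+1)} \<le> 2^(j+1)"
proof -
  let ?n = "2^j :: nat"
  let ?S = "{p::nat. prime p \<and> ?n < p \<and> p \<le> 2^(j+1)}"
  have "prime p \<and> p dvd ((2 * ?n) choose ?n)" if "p \<in> ?S" for p
  proof -
    have p: "prime p" "?n < p" "p \<le> 2 * ?n" using that by auto
    have "fact ?n * fact (2 * ?n - ?n) * ((2 * ?n) choose ?n) = (fact (2 * ?n) :: nat)"
      by (rule binomial_fact_lemma) simp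
    moreover have "p dvd fact (2 * ?n)" "\<not> p dvd fact ?n" "\<not> p dvd fact (2 * ?n - ?n)"
      using p by (auto simp: prime_dvd_fact_iff)
    ultimately show ?thesis using p(1) by (metis prime_dvd_mult_iff)
  qed
  then have "\<Prod>?S dvd ((2 * ?n) choose ?n)"
    by (intro prod_primes_dvd) auto
  then have "\<Prod>?S \<le> ((2 * ?n) choose ?n)"
    by (intro dvd_imp_le) auto
  also have "\<dots> \<le> 2 ^ (2 * ?n)"
    by (rule binomial_le_pow2)
  finally have "\<Prod>?S \<le> 2 ^ (2 * ?n)" .
  moreover have "(\<Prod>p\<in>?S. 2^j) \<le> \<Prod>?S"
    by (rule prod_mono) auto
  ultimately have "(2::nat) ^ (j * card ?S) \<le> 2 ^ (2 * ?n)"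
    by (simp add: power_mult)
  then show ?thesis by simp
qed

text \<open>Adds up the dyadic ranges by induction; for \<open>i \<le> 4\<close> the trivial count
  suffices.\<close>

lemma card_primes_le_pow2:
  assumes "i \<ge> 1"
  shows "i * card {p::nat. prime p \<and> p \<le> 2^i} \<le> 4 * 2^i"
  using assms
proof (induction i rule: nat_less_induct)
  case (1 i)
  show ?case
  proof (cases "i \<le> 4")
    case True
    have "card {p::nat. prime p \<and> p \<le> 2^i} \<le> card {1..2^i::nat}"
      by (rule card_mono) (auto dest: prime_gt_0_nat simp: Suc_le_eq)
    then show ?thesis using True by (intro mult_mono) auto
  next
    case False
    then obtain j where j: "i = Suc j" "j \<ge> 4" by (cases i) auto
    let ?A = "{p::nat. prime p \<and> p \<le> 2^j}" and ?B = "{p::nat. prime p \<and> 2^j < p \<and> p \<le> 2^(j+1)}"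
    have fin: "finite ?A" by (rule finite_subset[of _ "{..2^j}"]) auto
    have "{p::nat. prime p \<and> p \<le> 2^i} \<subseteq> ?A \<union> ?B" using j by auto
    then have "card {p::nat. prime p \<and> p \<le> 2^i} \<le> card (?A \<union> ?B)"
      using fin by (intro card_mono) auto
    also have "\<dots> \<le> card ?A + card ?B" by (rule card_Un_le)
    finally have le: "card {p::nat. prime p \<and> p \<le> 2^i} \<le> card ?A + card ?B" .
    have a: "j * card ?A \<le> 4 * 2^j" using 1 j by auto
    have b: "j * card ?B \<le> 2 * 2^j" using card_primes_dyadic[of j] by simp
    have "j * card {p::nat. prime p \<and> p \<le> 2^i} \<le> 6 * 2^j"
      using mult_le_mono2[OF le, of j] a b by (simp add: distrib_left)
    \<comment> \<open>Here \<open>i / j \<le> 4 / 3\<close> since \<open>j \<ge> 4\<close>, and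
      \<open>4 / 3 * 6 * 2 ^ j = 4 * 2 ^ i\<close> restores the constant 4.\<close>
    moreover have "3 * (i * card {p::nat. prime p \<and> p \<le> 2^i}) \<le> 4 * (j * card {p::nat. prime p \<and> p \<le> 2^i})"
      unfolding mult.assoc [symmetric] using j by (intro mult_le_mono1) simp
    moreover have "(2::nat) ^ i = 2 * 2 ^ j" using j by simp
    ultimately show ?thesis by linarith
  qed
qed

text \<open>Leibniz harmonic triangle: the fractions \<open>u(n, k) = 1 / (k * (n choose k))\<close> satisfy
  \<open>u(n, k) + u(n, k + 1) = u(n - 1, k)\<close>.\<close>
lemma mult_binomial_dvd_common_multiple:
  fixes L :: nat
  assumes "1 \<le> k" "k \<le> n" "\<And>i. 1 \<le> i \<Longrightarrow> i \<le> n \<Longrightarrow> i dvd L"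
  shows "k * (n choose k) dvd L"
proof -
  \<comment> \<open>Integer quotients over the reals, because the induction step subtracts one
    quotient from another.\<close>
  have "\<exists>z::int. real_of_int z * (real k * real (n choose k)) = real L"
    using assms
  proof (induction k arbitrary: n rule: dec_induct)
    case base
    then obtain z where "L = n * z" by (metis dvdE order_refl)
    then show ?case by (intro exI[of _ "int z"]) simp
  next
    case (step k)
    then obtain m where m: "n = Suc m" "k \<le> m" by (cases n) auto
    obtain z1 where z1: "real_of_int z1 * (real k * real (m choose k)) = real L"
      using step.IH[of m] step.prems m by auto
    obtain z2 where z2: "real_of_int z2 * (real k * real (n choose k)) = real L"
      using step.IH[of n] step.prems m by auto
    have pos: "real (m choose k) > 0" "real (n choose k) > 0" "real (n choose Suc k) > 0"
      using m step.prems by (auto simp: zero_less_binomial_iff simp del: binomial_Suc_Suc)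
    have k: "real k > 0" using step by simp
    have e1: "real (Suc k) * real (n choose Suc k) = real n * real (m choose k)"
      using Suc_times_binomial_eq[of m k] m by (metis mult.commute of_nat_mult)
    have e2: "(real n - real k) * real (n choose k) = real n * real (m choose k)"
    proof -
      have "(n - k) * (n choose k) = n * (m choose k)"
        using binomial_absorb_comp[of n k] m by simp
      then show ?thesis using m by (metis le_Suc_eq of_nat_diff of_nat_mult)
    qed
    \<comment> \<open>In the notation of the triangle, \<open>z1 = L * u(n - 1, k)\<close> and
      \<open>z2 = L * u(n, k)\<close>, so the difference is \<open>L * u(n, k + 1)\<close>.\<close>
    have "(real_of_int z1 - real_of_int z2) * (real n * real (m choose k)) = real L"
    proof -
      have "(real_of_int z1 - real_of_int z2) * (real n * real (m choose k)) * real k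
        = real n * (real_of_int z1 * (real k * real (m choose k)))
          - (real n - real k) * (real_of_int z2 * (real k * real (n choose k)))"
        by (simp add: algebra_simps flip: e2)
      also have "\<dots> = real L * real k" unfolding z1 z2 by (simp add: algebra_simps)
      finally show ?thesis using k by simp
    qed
    then show ?case unfolding e1 by (intro exI[of _ "z1 - z2"]) simp
  qed
  then obtain z :: int where "real_of_int z * (real k * real (n choose k)) = real L" by auto
  then have "real_of_int (z * (int k * int (n choose k))) = real_of_int (int L)" by simp
  then have "z * int (k * (n choose k)) = int L" by (metis of_int_eq_iff of_nat_mult)
  then have "int (k * (n choose k)) dvd int L" by (metis dvd_triv_right)
  then show ?thesis by (simp only: int_dvd_int_iff)
qed

text \<open>Take the least common multiple of \<open>1, ..., n\<close>. The exponent of a prime in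
  it is attained by some \<open>i \<le> n\<close>, so every prime power in it is at most
  \<open>n\<close>, and only primes up to \<open>n\<close> occur.\<close>

lemma ex_common_multiple_le_power:
  assumes "n \<ge> 1"
  shows "\<exists>L>0. L \<le> n ^ card {p::nat. prime p \<and> p \<le> n} \<and> (\<forall>i. 1 \<le> i \<longrightarrow> i \<le> n \<longrightarrow> i dvd L)"
proof -
  let ?P = "{p::nat. prime p \<and> p \<le> n}"
  have fin: "finite ?P" by (rule finite_subset[of _ "{..n}"]) auto
  define L where "L = Lcm {1..n}"
  have L0: "L \<noteq> 0" unfolding L_def by (subst Lcm_0_iff) auto
  have dv: "i dvd L" if "1 \<le> i" "i \<le> n" for i using that unfolding L_def by (intro dvd_Lcm) auto
  \<comment> \<open>If every \<open>i\<close> had a smaller exponent at \<open>p\<close>, dividing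
    \<open>L\<close> by \<open>p\<close> would leave a smaller common multiple.\<close>
  have mult: "\<exists>i\<in>{1..n}. multiplicity p L \<le> multiplicity p i" if p: "prime p" for p
  proof (rule ccontr)
    assume "\<not> ?thesis"
    then have lt: "multiplicity p i < multiplicity p L" if "i \<in> {1..n}" for i
      using that by (meson linorder_not_less)
    then have pos: "multiplicity p L > 0" using assms by (metis atLeastAtMost_iff gr_zeroI not_less_zero order_refl)
    then obtain M where M: "L = p * M" by (metis dvdE not_dvd_imp_multiplicity_0 neq0_conv)
    have M0: "M \<noteq> 0" using L0 M by auto
    have mM: "multiplicity p L = Suc (multiplicity p M)"
      unfolding M using M0 p by (subst prime_elem_multiplicity_mult_distrib) auto
    have "i dvd M" if i: "i \<in> {1..n}" for i
    proof (rule multiplicity_le_imp_dvd)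
      show "i \<noteq> 0" using i by auto
      fix q :: nat assume q: "prime q"
      show "multiplicity q i \<le> multiplicity q M"
      proof (cases "q = p")
        case True then show ?thesis using lt[OF i] mM by simp
      next
        case False
        have "multiplicity q L = multiplicity q M"
          unfolding M using M0 p q False
          by (subst prime_elem_multiplicity_mult_distrib) (auto simp: prime_multiplicity_other)
        moreover have "multiplicity q i \<le> multiplicity q L"
          using dv i L0 by (intro dvd_imp_multiplicity_le) auto
        ultimately show ?thesis by simp
      qed
    qed
    then have "L dvd M" unfolding L_def by (intro Lcm_least) auto
    then have "L \<le> M" using M0 by (intro dvd_imp_le) auto
    moreover have "p \<ge> 2" using p prime_ge_2_nat by auto
    ultimately show False using M M0 by auto
  qed
  have sub: "prime_factors L \<subseteq> ?P"
  proof
    fix p assume p: "p \<in> prime_factors L"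
    then have pp: "prime p" "p dvd L" by auto
    then have "multiplicity p L > 0" using L0 by (simp add: prime_multiplicity_gt_zero_iff)
    with mult[OF pp(1)] obtain i where i: "i \<in> {1..n}" "multiplicity p i > 0" by force
    then have "p dvd i" by (metis not_dvd_imp_multiplicity_0 neq0_conv)
    then have "p \<le> n" using i by (meson atLeastAtMost_iff dvd_imp_le le_trans less_le_trans zero_less_one)
    then show "p \<in> ?P" using pp by auto
  qed
  have "L = (\<Prod>p\<in>prime_factors L. p ^ multiplicity p L)"
    using L0 by (simp add: prod_prime_factors)
  also have "\<dots> \<le> (\<Prod>p\<in>prime_factors L. n)"
  proof (rule prod_mono, safe)
    fix p assume "p \<in> prime_factors L"
    then have p: "prime p" by auto
    then obtain i where i: "i \<in> {1..n}" "multiplicity p L \<le> multiplicity p i" using mult by blast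
    have "p ^ multiplicity p L dvd i" using i(2) by (rule multiplicity_dvd')
    then show "p ^ multiplicity p L \<le> n" using i by (meson atLeastAtMost_iff dvd_imp_le le_trans less_le_trans zero_less_one)
  qed
  also have "\<dots> = n ^ card (prime_factors L)" by simp
  also have "\<dots> \<le> n ^ card ?P"
    using assms sub fin by (intro power_increasing card_mono) auto
  finally show ?thesis using L0 dv by blast
qed

text \<open>Nair's argument with \<open>n = 2 ^ (i - 1)\<close>:
  \<open>n * ((2 * n) choose n)\<close> is at least \<open>4 ^ n / 2\<close> and divides every
  common multiple of \<open>1, ..., 2 * n\<close>, one of which is at most \<open>2 * n\<close> to
  the power of the number of primes. Exponents of 2 are compared.\<close>

lemma card_primes_ge_pow2:
  assumes "i \<ge> 1"
  shows "2 ^ i \<le> 2 * i * card {p::nat. prime p \<and> p \<le> 2^i}"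
proof -
  let ?c = "card {p::nat. prime p \<and> p \<le> 2^i}"
  obtain j where j: "i = Suc j" using assms by (cases i) auto
  let ?n = "2^j :: nat"
  obtain L :: nat where L: "L > 0" "L \<le> (2^i) ^ ?c" "\<And>k. 1 \<le> k \<Longrightarrow> k \<le> 2^i \<Longrightarrow> k dvd L"
    using ex_common_multiple_le_power[of "2^i"] by auto
  have "?n * ((2 * ?n) choose ?n) dvd L"
    using L(3) j by (intro mult_binomial_dvd_common_multiple) auto
  then have "?n * ((2 * ?n) choose ?n) \<le> L" using L(1) by (intro dvd_imp_le) auto
  with L(2) have le: "?n * ((2 * ?n) choose ?n) \<le> 2 ^ (i * ?c)" by (simp add: power_mult)
  have "4 ^ ?n / (2 * real ?n) \<le> real ((2 * ?n) choose ?n)"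
    by (rule central_binomial_lower_bound) simp
  then have "4 ^ ?n \<le> 2 * real (?n * ((2 * ?n) choose ?n))"
    by (simp add: field_simps)
  also have "\<dots> \<le> 2 * real (2 ^ (i * ?c))" using le by (intro mult_left_mono) (auto simp del: of_nat_power of_nat_mult)
  finally have "(2::real) ^ (2 * ?n) \<le> 2 ^ (i * ?c + 1)" by (simp add: power_mult)
  then have "2 * ?n \<le> i * ?c + 1" by (metis one_less_numeral_iff power_le_imp_le_exp semiring_norm(76))
  then have b: "2 ^ i \<le> i * ?c + 1" using j by simp
  have "?c > 0"
  proof -
    have "2 \<in> {p::nat. prime p \<and> p \<le> 2^i}" using self_le_power[of "2::nat" i] assms by auto
    moreover have "finite {p::nat. prime p \<and> p \<le> 2^i}" by (rule finite_subset[of _ "{..2^i}"]) auto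
    ultimately show ?thesis by (metis card_gt_0_iff empty_iff)
  qed
  then have "i * ?c \<ge> 1" using assms by simp
  with b show ?thesis by linarith
qed

text \<open>The ratio 32 is large enough for the two Chebyshev bounds, which differ by a constant
  factor, to give primes in every block with \<open>k \<ge> 1\<close>.\<close>

definition block_primes :: "nat \<Rightarrow> nat set" where
  "block_primes k = {p. prime p \<and> 32 ^ k \<le> p \<and> p < 32 ^ (k + 1)}"

lemma finite_block_primes [simp]: "finite (block_primes k)"
  unfolding block_primes_def by (rule finite_subset[of _ "{..32 ^ (k + 1)}"]) auto

text \<open>A block is covered by five dyadic ranges with \<open>j \<ge> 5 * k\<close>, each of
  reciprocal mass at most \<open>2 / j\<close>.\<close>

lemma sum_inverse_block_primes_le:
  assumes "k \<ge> 1"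
  shows "(\<Sum>p\<in>block_primes k. 1 / real p) \<le> 2 / real k"
proof -
  let ?D = "\<lambda>j. {p::nat. prime p \<and> 2^j < p \<and> p \<le> 2^(j+1)}"
  have "block_primes k \<subseteq> (\<Union>j\<in>{5*k..<5*k+5}. ?D j)"
  proof
    fix p assume "p \<in> block_primes k"
    then have p: "prime p" "32^k \<le> p" "p < 32^(k+1)" by (auto simp: block_primes_def)
    have e: "(32::nat)^k = 2^(5*k)" "(32::nat)^(k+1) = 2^(5*k+5)"
      by (simp_all add: power_mult power_add)
    \<comment> \<open>The endpoint is not prime, which reconciles blocks closed on the left with
      dyadic ranges open on the left.\<close>
    have "\<not> prime ((2::nat) ^ (5*k))" by (subst prime_power_iff) auto
    then have "p \<noteq> 2 ^ (5*k)" using p(1) by metis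
    then have l: "2^(5*k) < p" using p e by simp
    define j where "j = (LEAST j. p \<le> 2^(j+1))"
    have ex: "p \<le> 2^(5*k+4+1)" using p(3) unfolding e(2) by (simp add: ac_simps)
    have j1: "p \<le> 2^(j+1)" unfolding j_def using ex by (rule LeastI)
    have j2: "j \<le> 5*k+4" unfolding j_def using ex by (rule Least_le)
    have j3: "5*k \<le> j"
    proof (rule ccontr)
      assume "\<not> ?thesis"
      then have "(2::nat)^(j+1) \<le> 2^(5*k)" by (intro power_increasing) auto
      then show False using l j1 by simp
    qed
    have "2^j < p"
    proof (cases j)
      case 0 then show ?thesis using p(1) prime_gt_1_nat by simp
    next
      case (Suc i)
      then have "\<not> p \<le> 2^(i+1)" using not_less_Least[of i "\<lambda>j. p \<le> 2^(j+1)"] j_def by auto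
      then show ?thesis using Suc by simp
    qed
    with j1 j2 j3 p(1) show "p \<in> (\<Union>j\<in>{5*k..<5*k+5}. ?D j)" by auto
  qed
  then have "(\<Sum>p\<in>block_primes k. 1 / real p) \<le> (\<Sum>p\<in>(\<Union>j\<in>{5*k..<5*k+5}. ?D j). 1 / real p)"
    by (intro sum_mono2) auto
  also have "\<dots> \<le> (\<Sum>j\<in>{5*k..<5*k+5}. \<Sum>p\<in>?D j. 1 / real p)"
    by (rule sum_UNION_le) auto
  also have "\<dots> \<le> (\<Sum>j\<in>{5*k..<5*k+5}. 2 / (5 * real k))"
  proof (rule sum_mono)
    fix j assume j: "j \<in> {5*k..<5*k+5}"
    then have j0: "real j > 0" using assms by auto
    have "(\<Sum>p\<in>?D j. 1 / real p) \<le> (\<Sum>p\<in>?D j. 1 / 2^j)"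
    proof (rule sum_mono)
      fix p assume "p \<in> ?D j"
      then have "(2::real)^j \<le> real p" by (metis (mono_tags, lifting) less_imp_le mem_Collect_eq of_nat_le_iff of_nat_numeral of_nat_power)
      then show "1 / real p \<le> 1 / 2^j" by (intro frac_le) auto
    qed
    also have "\<dots> = real (card (?D j)) / 2^j" by simp
    also have "\<dots> \<le> 2 / real j"
    proof -
      have "real (j * card (?D j)) \<le> real (2^(j+1))" using card_primes_dyadic[of j] by (simp only: of_nat_le_iff)
      then show ?thesis using j0 by (simp add: field_simps)
    qed
    also have "\<dots> \<le> 2 / (5 * real k)" using j assms j0 by (intro divide_left_mono) auto
    finally show "(\<Sum>p\<in>?D j. 1 / real p) \<le> 2 / (5 * real k)" .
  qed
  also have "\<dots> = 2 / real k" by simp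
  finally show ?thesis .
qed

text \<open>With \<open>X = 32 ^ k\<close> and counts scaled by \<open>10 * (k + 1)\<close>, there
  are at least \<open>32 * X\<close> primes up to \<open>32 * X\<close> and at most
  \<open>16 * X\<close> up to \<open>X\<close>. The difference lies in the block, where each
  reciprocal is at least \<open>1 / (32 * X)\<close>.\<close>

lemma sum_inverse_block_primes_ge:
  assumes "k \<ge> 1"
  shows "1 / (20 * real (k + 1)) \<le> (\<Sum>p\<in>block_primes k. 1 / real p)"
proof -
  let ?\<pi> = "\<lambda>i. {p::nat. prime p \<and> p \<le> 2^i}"
  let ?J = "5 * (k + 1)"
  have e: "(32::nat)^k = 2^(5*k)" "(32::nat)^(k+1) = 2^?J"
    by (simp_all add: power_mult power_add)
  have np: "\<not> prime ((2::nat)^?J)" by (subst prime_power_iff) auto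
  have fin: "finite (?\<pi> i)" for i by (rule finite_subset[of _ "{..2^i}"]) auto
  have "?\<pi> ?J \<subseteq> ?\<pi> (5*k) \<union> block_primes k"
    using e np by (auto simp: block_primes_def order_le_less)
  then have "card (?\<pi> ?J) \<le> card (?\<pi> (5*k) \<union> block_primes k)"
    using fin by (intro card_mono) auto
  also have "\<dots> \<le> card (?\<pi> (5*k)) + card (block_primes k)" by (rule card_Un_le)
  finally have c: "real (card (?\<pi> ?J)) \<le> real (card (?\<pi> (5*k))) + real (card (block_primes k))" by linarith
  define X where "X = (32::real) ^ k"
  have X: "X > 0" by (simp add: X_def)
  have "real (2 ^ ?J) \<le> real (2 * ?J * card (?\<pi> ?J))"
    using card_primes_ge_pow2[of ?J] by (subst of_nat_le_iff) auto
  then have c1: "32 * X \<le> 10 * real (k + 1) * real (card (?\<pi> ?J))"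
  proof -
    have "real (2 ^ ?J) = 32 * X" unfolding X_def by (simp add: power_mult power_add)
    then show ?thesis
      using \<open>real (2 ^ ?J) \<le> real (2 * ?J * card (?\<pi> ?J))\<close> by (simp only: of_nat_mult of_nat_add)
  qed
  have "real (5 * k * card (?\<pi> (5*k))) \<le> real (4 * 2^(5*k))"
    using card_primes_le_pow2[of "5*k"] assms by (subst of_nat_le_iff) auto
  then have c2: "5 * real k * real (card (?\<pi> (5*k))) \<le> 4 * X"
    unfolding X_def by (simp add: power_mult)
  have c2': "10 * real (k + 1) * real (card (?\<pi> (5*k))) \<le> 16 * X"
  proof -
    have "10 * real (k + 1) * real (card (?\<pi> (5*k))) \<le> 20 * real k * real (card (?\<pi> (5*k)))"
      using assms by (intro mult_right_mono) auto
    also have "\<dots> \<le> 16 * X" using c2 by simp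
    finally show ?thesis .
  qed
  have "32 * X \<le> 16 * X + 10 * real (k + 1) * real (card (block_primes k))"
  proof -
    have "10 * real (k + 1) * real (card (?\<pi> ?J)) \<le> 10 * real (k + 1) * (real (card (?\<pi> (5*k))) + real (card (block_primes k)))"
      using c by (intro mult_left_mono) auto
    then show ?thesis using c1 c2' by (simp add: distrib_left)
  qed
  then have "16 * X \<le> 10 * real (k + 1) * real (card (block_primes k))" by simp
  then have "1 / (20 * real (k + 1)) \<le> real (card (block_primes k)) / (32 * X)"
    using X by (simp add: field_simps)
  also have "\<dots> = (\<Sum>p\<in>block_primes k. 1 / (32 * X))" by simp
  also have "\<dots> \<le> (\<Sum>p\<in>block_primes k. 1 / real p)"
  proof (rule sum_mono)
    fix p assume "p \<in> block_primes k"
    then have p: "prime p" "p < 32^(k+1)" by (auto simp: block_primes_def)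
    then have "real p \<le> real (32^(k+1))" by (simp only: of_nat_le_iff)
    then have "real p \<le> 32 * X" by (simp add: X_def)
    then show "1 / (32 * X) \<le> 1 / real p" using prime_gt_0_nat[OF p(1)] X by (intro divide_left_mono) auto
  qed
  finally show ?thesis .
qed

text \<open>Mertens' estimate by double counting the pairs of a prime \<open>p\<close> and a
  multiple \<open>k \<le> n\<close> of it, weighted by \<open>ln p\<close>. For fixed
  \<open>k\<close> the distinct prime divisors have product at most \<open>n\<close>; for fixed
  \<open>p\<close> there are \<open>n div p \<ge> n / (2 * p)\<close> multiples, whence the factor
  2.\<close>

lemma sum_ln_div_prime_le:
  assumes "n \<ge> 1"
  shows "(\<Sum>p | prime p \<and> p \<le> n. ln (real p) / real p) \<le> 2 * ln (real n)"
proof -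
  let ?P = "{p::nat. prime p \<and> p \<le> n}"
  have fin: "finite ?P" by (rule finite_subset[of _ "{..n}"]) auto
  have "(\<Sum>p\<in>?P. real n / (2 * real p) * ln (real p)) \<le> (\<Sum>p\<in>?P. real (n div p) * ln (real p))"
  proof (rule sum_mono, rule mult_right_mono)
    fix p assume p: "p \<in> ?P"
    then have p': "p \<ge> 2" "p \<le> n" using prime_ge_2_nat by auto
    have "n div p \<ge> 1" using p' by (simp add: div_greater_zero_iff Suc_le_eq)
    then have "p \<le> p * (n div p)" by simp
    moreover have "n < p * (n div p) + p" using p' by (metis mult_div_mod_eq mod_less_divisor nat_add_left_cancel_less not_numeral_le_zero gr0I)
    ultimately have "n \<le> 2 * (p * (n div p))" by linarith
    then have "real n \<le> real (2 * (p * (n div p)))" by (simp only: of_nat_le_iff)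
    then show "real n / (2 * real p) \<le> real (n div p)" using p' by (simp add: field_simps)
    show "0 \<le> ln (real p)" using p' by simp
  qed
  also have "\<dots> = (\<Sum>p\<in>?P. \<Sum>k\<in>{1..n}. if p dvd k then ln (real p) else 0)"
  proof (rule sum.cong[OF refl])
    fix p assume p: "p \<in> ?P"
    then have "p > 0" by (auto dest: prime_gt_0_nat)
    have "{k\<in>{1..n}. p dvd k} = (\<lambda>i. p * i) ` {1..n div p}"
    proof (intro set_eqI iffI)
      fix k assume "k \<in> {k\<in>{1..n}. p dvd k}"
      then obtain i where i: "k = p * i" "1 \<le> k" "k \<le> n" by auto
      then have "i \<le> n div p" using \<open>p > 0\<close> by (simp add: less_eq_div_iff_mult_less_eq mult.commute)
      moreover have "i \<ge> 1" using i by (cases i) auto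
      ultimately show "k \<in> (\<lambda>i. p * i) ` {1..n div p}" using i by auto
    next
      fix k assume "k \<in> (\<lambda>i. p * i) ` {1..n div p}"
      then obtain i where "k = p * i" "1 \<le> i" "i \<le> n div p" by fastforce
      then show "k \<in> {k\<in>{1..n}. p dvd k}" using \<open>p > 0\<close>
        by (auto simp: less_eq_div_iff_mult_less_eq mult.commute Suc_le_eq)
    qed
    moreover have "inj_on (\<lambda>i. p * i) {1..n div p}" using \<open>p > 0\<close> by (auto simp: inj_on_def)
    ultimately have "card {k\<in>{1..n}. p dvd k} = n div p" by (simp add: card_image)
    then show "real (n div p) * ln (real p) = (\<Sum>k\<in>{1..n}. if p dvd k then ln (real p) else 0)"
      by (simp flip: sum.inter_filter)
  qed
  also have "\<dots> = (\<Sum>k\<in>{1..n}. \<Sum>p\<in>?P. if p dvd k then ln (real p) else 0)"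
    by (rule sum.swap)
  also have "\<dots> \<le> (\<Sum>k\<in>{1..n}. ln (real n))"
  proof (rule sum_mono)
    fix k assume k: "k \<in> {1..n}"
    let ?S = "{p\<in>?P. p dvd k}"
    have "(\<Sum>p\<in>?P. if p dvd k then ln (real p) else 0) = (\<Sum>p\<in>?S. ln (real p))"
      using fin by (simp flip: sum.inter_filter)
    also have "\<dots> = ln (\<Prod>p\<in>?S. real p)"
      using fin by (intro ln_prod[symmetric]) (auto dest: prime_gt_0_nat)
    also have "\<dots> = ln (real (\<Prod>?S))" by simp
    also have "\<dots> \<le> ln (real n)"
    proof -
      have "\<Prod>?S dvd k" using fin by (intro prod_primes_dvd) auto
      then have "\<Prod>?S \<le> n" using k by (meson atLeastAtMost_iff dvd_imp_le le_trans less_le_trans zero_less_one)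
      moreover from this have "n > 0" using assms by simp
      moreover have "\<Prod>?S > 0" by (rule prod_pos) (auto dest: prime_gt_0_nat)
      ultimately show ?thesis by (subst ln_le_cancel_iff) (simp_all only: of_nat_le_iff of_nat_0_less_iff)
    qed
    finally show "(\<Sum>p\<in>?P. if p dvd k then ln (real p) else 0) \<le> ln (real n)" .
  qed
  also have "\<dots> = real n * ln (real n)" by simp
  finally have "(\<Sum>p\<in>?P. real n / (2 * real p) * ln (real p)) \<le> real n * ln (real n)" .
  moreover have "(\<Sum>p\<in>?P. real n / (2 * real p) * ln (real p)) = real n / 2 * (\<Sum>p\<in>?P. ln (real p) / real p)"
    by (simp add: sum_distrib_left field_simps)
  ultimately have "real n * (\<Sum>p\<in>?P. ln (real p) / real p) \<le> real n * (2 * ln (real n))"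
    by (simp add: algebra_simps)
  then show ?thesis using assms by (subst (asm) mult_le_cancel_left_pos) auto
qed

section \<open>Weighted sets of primes\<close>

lemma prime_dvd_prod_primes_iff:
  fixes p :: nat
  assumes "finite X" "\<And>q. q \<in> X \<Longrightarrow> prime q" "prime p"
  shows "p dvd \<Prod>X \<longleftrightarrow> p \<in> X"
proof -
  have "p dvd \<Prod>X \<longleftrightarrow> (\<exists>q\<in>X. p dvd q)"
    using assms by (simp add: prime_dvd_prod_iff)
  also have "\<dots> \<longleftrightarrow> p \<in> X"
    using assms(2) primes_dvd_imp_eq[OF assms(3)] by (metis dvd_refl)
  finally show ?thesis .
qed

lemma prod_primes_inj:
  fixes X Y :: "nat set"
  assumes "finite X" "\<And>q. q \<in> X \<Longrightarrow> prime q" "finite Y" "\<And>q. q \<in> Y \<Longrightarrow> prime q" "\<Prod>X = \<Prod>Y"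
  shows "X = Y"
proof (intro set_eqI)
  fix q
  show "q \<in> X \<longleftrightarrow> q \<in> Y"
    using prime_dvd_prod_primes_iff[OF assms(1,2), of q] prime_dvd_prod_primes_iff[OF assms(3,4), of q]
      assms(2)[of q] assms(4)[of q] assms(5) by auto
qed

lemma sum_Pow_prod:
  fixes f :: "'a \<Rightarrow> 'b :: comm_semiring_1"
  assumes "finite S"
  shows "(\<Sum>X\<in>Pow S. prod f X) = (\<Prod>p\<in>S. 1 + f p)"
  using prod_add[OF assms, of f "\<lambda>_. 1"] by (simp only: add.commute[of 1] prod.neutral_const mult_1_right)

text \<open>Probabilistically: a random set containing each \<open>p\<close> independently with odds
  \<open>f p\<close> contains \<open>p\<close> with probability
  \<open>f p / (1 + f p) \<le> f p\<close>, so the mean of \<open>sum g X\<close> is at most the sum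
  of \<open>f p * g p\<close>. The product is the normalising factor.\<close>

lemma sum_Pow_prod_mult_sum_le:
  fixes f g :: "'a \<Rightarrow> real"
  assumes "finite S" "\<And>p. 0 \<le> f p" "\<And>p. p \<in> S \<Longrightarrow> 0 \<le> g p"
  shows "(\<Sum>X\<in>Pow S. prod f X * sum g X) \<le> (\<Prod>p\<in>S. 1 + f p) * (\<Sum>p\<in>S. f p * g p)"
  using assms(1,3)
proof (induction S rule: finite_induct)
  case (insert q S)
  let ?T = "\<Prod>p\<in>S. 1 + f p" and ?A = "\<Sum>X\<in>Pow S. prod f X * sum g X" and ?\<Sigma> = "\<Sum>p\<in>S. f p * g p"
  have fin: "finite X" "q \<notin> X" if "X \<in> Pow S" for X
    using that insert finite_subset by auto
  have T: "?T = (\<Sum>X\<in>Pow S. prod f X)" by (rule sum_Pow_prod[OF insert(1), symmetric])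
  have T0: "?T \<ge> 0" using assms(2) by (intro prod_nonneg) (auto simp: add_nonneg_nonneg)
  have "(\<Sum>X\<in>Pow (insert q S). prod f X * sum g X)
    = ?A + (\<Sum>X\<in>insert q ` Pow S. prod f X * sum g X)"
    unfolding Pow_insert using insert by (intro sum.union_disjoint) auto
  also have "(\<Sum>X\<in>insert q ` Pow S. prod f X * sum g X) = (\<Sum>X\<in>Pow S. f q * prod f X * (g q + sum g X))"
  proof (subst sum.reindex)
    show "inj_on (insert q) (Pow S)" using fin by (intro inj_onI) (metis insert_ident)
    show "sum ((\<lambda>X. prod f X * sum g X) \<circ> insert q) (Pow S) = (\<Sum>X\<in>Pow S. f q * prod f X * (g q + sum g X))"
      using fin by (intro sum.cong) auto
  qed
  also have "\<dots> = f q * (g q * ?T + ?A)"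
    unfolding T by (simp add: sum_distrib_left sum.distrib algebra_simps)
  finally have e: "(\<Sum>X\<in>Pow (insert q S). prod f X * sum g X) = (1 + f q) * ?A + f q * g q * ?T"
    by (simp add: algebra_simps)
  have "(1 + f q) * ?A \<le> (1 + f q) * (?T * ?\<Sigma>)"
    using insert assms(2)[of q] by (intro mult_left_mono) auto
  moreover have "f q * g q * ?T \<le> (1 + f q) * (f q * g q * ?T)"
    using assms(2)[of q] insert.prems T0 by (simp add: algebra_simps)
  ultimately have "(\<Sum>X\<in>Pow (insert q S). prod f X * sum g X) \<le> (1 + f q) * ?T * (f q * g q + ?\<Sigma>)"
    unfolding e by (simp add: algebra_simps)
  then show ?case using insert.hyps by simp
qed auto

text \<open>Unnormalised probabilities: each prime enters independently, with odds
  \<open>1 / (2 * p)\<close> here and \<open>1 / p\<close> in \<open>full_weight\<close>.\<close>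

definition half_weight :: "nat set \<Rightarrow> real" where
  "half_weight X = (\<Prod>p\<in>X. 1 / (2 * real p))"

definition full_weight :: "nat set \<Rightarrow> real" where
  "full_weight X = (\<Prod>p\<in>X. 1 / real p)"

lemma half_weight_nonneg [simp]: "0 \<le> half_weight X"
  unfolding half_weight_def by (intro prod_nonneg) auto

lemma full_weight_nonneg [simp]: "0 \<le> full_weight X"
  unfolding full_weight_def by (intro prod_nonneg) auto

lemma half_weight_eq: "half_weight X = 1 / (2 ^ card X * real (\<Prod>X))"
  by (simp add: half_weight_def prod_dividef prod.distrib)

lemma full_weight_eq: "full_weight X = 1 / real (\<Prod>X)"
  by (simp add: full_weight_def prod_dividef)

text \<open>By unique factorization at most one set of primes has product \<open>s\<close>, and its
  weight is exactly \<open>1 / s\<close>.\<close>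

lemma sum_full_weight_fibre_le:
  assumes "finite S" "\<And>p. p \<in> S \<Longrightarrow> prime p"
  shows "(\<Sum>U | U \<in> Pow S \<and> \<Prod>U = s. full_weight U) \<le> 1 / real s"
proof (cases "\<exists>U\<in>Pow S. \<Prod>U = s")
  case True
  then obtain U where U: "U \<subseteq> S" "\<Prod>U = s" by auto
  have "V = U" if "V \<in> Pow S" "\<Prod>V = s" for V
    using that U assms by (intro prod_primes_inj) (auto intro: finite_subset)
  then have "{U. U \<in> Pow S \<and> \<Prod>U = s} = {U}" using U by blast
  then show ?thesis using U by (simp add: full_weight_eq)
next
  case False
  then have eq: "{U. U \<in> Pow S \<and> \<Prod>U = s} = {}" by auto
  show ?thesis unfolding eq by simp
qed

text \<open>If \<open>k\<close> primes divide \<open>s\<close>, counted with multiplicity, then each of the at most \<open>2\<^sup>k\<close>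
  factorizations has weight \<open>2\<^sup>-\<^sup>k / s\<close>.\<close>
lemma sum_half_weight_fibre_le:
  assumes S: "finite S" "\<And>p. p \<in> S \<Longrightarrow> prime p"
  shows "(\<Sum>(X, Y) | X \<in> Pow S \<and> Y \<in> Pow S \<and> \<Prod>X * \<Prod>Y = s. half_weight X * half_weight Y) \<le> 1 / real s"
    (is "sum ?w ?A \<le> _")
proof (cases "?A = {}")
  case False
  then obtain X0 Y0 where 0: "X0 \<subseteq> S" "Y0 \<subseteq> S" "\<Prod>X0 * \<Prod>Y0 = s" by auto
  have fin: "finite X" if "X \<subseteq> S" for X using that S finite_subset by auto
  have pos: "\<Prod>X > 0" if "X \<subseteq> S" for X
    using that S prime_gt_0_nat by (intro prod_pos) blast
  have s: "s > 0" using 0 pos by force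
  define k where "k = size (prime_factorization s)"
  have pf: "prime_factorization (\<Prod>X) = mset_set X" if "X \<subseteq> S" for X
  proof -
    have "prime_factorization (\<Prod>X) = (\<Sum>p\<in>X. prime_factorization p)"
      using that fin pos S by (intro prime_factorization_prod) (auto dest!: subsetD)
    also have "\<dots> = (\<Sum>p\<in>X. {#p#})"
      using that S by (intro sum.cong prime_factorization_prime) auto
    finally show ?thesis using fin[OF that] by (simp add: sum_multiset_singleton)
  qed
  have k: "k = card X + card Y" and sub: "X \<subseteq> prime_factors s" if "(X, Y) \<in> ?A" for X Y
  proof -
    have XY: "X \<subseteq> S" "Y \<subseteq> S" "s = \<Prod>X * \<Prod>Y" using that by auto
    then have "prime_factorization s = mset_set X + mset_set Y"
      using pf pos by (auto simp: prime_factorization_mult)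
    then show "k = card X + card Y" "X \<subseteq> prime_factors s"
      using XY fin by (auto simp: k_def)
  qed
  \<comment> \<open>\<open>X\<close> determines \<open>Y\<close> through the product
    \<open>s\<close>, and \<open>X\<close> is a subset of the prime factors of \<open>s\<close>, of
    which there are at most \<open>k\<close>. This gives the bound \<open>2 ^ k\<close> on the
    number of pairs.\<close>
  have inj: "inj_on fst ?A"
  proof (rule inj_onI, clarify)
    fix X Y X' Y' assume a: "X \<subseteq> S" "Y \<subseteq> S" "X' \<subseteq> S" "Y' \<subseteq> S" "s = \<Prod>X * \<Prod>Y" "\<Prod>X' * \<Prod>Y' = \<Prod>X * \<Prod>Y" "fst (X, Y) = fst (X', Y')"
    then have "\<Prod>Y = \<Prod>Y'" using pos[of X] by auto
    then have "Y = Y'" using a fin S by (intro prod_primes_inj) auto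
    then show "X = X' \<and> Y = Y'" using a by simp
  qed
  have cpf: "card (prime_factors s) \<le> k"
    unfolding k_def using size_mset_mono[of "mset_set (prime_factors s)" "prime_factorization s"]
    by (simp add: mset_set_set_mset_msubset)
  have "card ?A = card (fst ` ?A)" using inj by (simp add: card_image)
  also have "\<dots> \<le> card (Pow (prime_factors s))"
  proof (intro card_mono image_subsetI)
    fix z assume "z \<in> ?A"
    then show "fst z \<in> Pow (prime_factors s)" using sub[of "fst z" "snd z"] by (simp only: prod.collapse Pow_iff)
  qed simp
  also have "\<dots> \<le> 2 ^ k" using cpf by (simp add: card_Pow power_increasing)
  finally have c: "card ?A \<le> 2 ^ k" .
  have "sum ?w ?A = (\<Sum>z\<in>?A. 1 / (2 ^ k * real s))"
  proof (rule sum.cong[OF refl], clarify)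
    fix X Y assume XY: "X \<subseteq> S" "Y \<subseteq> S" "s = \<Prod>X * \<Prod>Y"
    then have "k = card X + card Y" by (intro k) auto
    then show "half_weight X * half_weight Y = 1 / (2 ^ k * real (\<Prod>X * \<Prod>Y))"
      by (simp add: half_weight_eq power_add)
  qed
  also have "\<dots> = real (card ?A) / (2 ^ k * real s)" by simp
  also have "\<dots> \<le> 2 ^ k / (2 ^ k * real s)"
    using c by (intro divide_right_mono) (auto simp flip: of_nat_le_iff)
  finally show ?thesis by simp
next
  case True
  show ?thesis unfolding True by simp
qed

section \<open>Lower bound for the product of \<open>1 + 1 / p\<close> over primes\<close>

lemma sum_inverse_squares_le: "(\<Sum>d = 1..n. 1 / (real d)\<^sup>2) \<le> 2"
proof -
  \<comment> \<open>The term \<open>- 1 / n\<close> makes the induction telescope.\<close>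
  have "(\<Sum>d = 1..n. 1 / (real d)\<^sup>2) \<le> 2 - 1 / real n" if "n \<ge> 1"
    using that
  proof (induction n rule: dec_induct)
    case (step n)
    then have "1 / (real (Suc n))\<^sup>2 \<le> 1 / real n - 1 / real (Suc n)"
      by (simp add: divide_simps power2_eq_square)
    then show ?case using step by simp
  qed simp
  then show ?thesis by (cases "n \<ge> 1") (auto intro: order_trans)
qed

lemma ln_le_sum_inverse: "ln (real n + 1) \<le> (\<Sum>k = 1..n. 1 / real k)"
proof (induction n)
  case (Suc n)
  have "ln (real (Suc n) + 1) - ln (real n + 1) = ln (1 + 1 / real (Suc n))"
  proof -
    have "1 + 1 / real (Suc n) = (real (Suc n) + 1) / (real n + 1)" by (simp add: field_simps)
    then show ?thesis by (simp only:) (subst ln_div, auto)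
  qed
  also have "\<dots> \<le> 1 / real (Suc n)" by (intro ln_add_one_self_le_self) auto
  finally show ?case using Suc by simp
qed simp

text \<open>Writing each \<open>k \<le> n\<close> as a squarefree number times a square bounds the
  harmonic sum by the product over primes times the sum of \<open>1 / d ^ 2\<close>, which is at
  most 2.\<close>

lemma prod_one_plus_inverse_primes_ge:
  assumes "n \<ge> 1"
  shows "ln (real n) / 2 \<le> (\<Prod>p | prime p \<and> p \<le> n. 1 + 1 / real p)"
proof -
  let ?S = "{p::nat. prime p \<and> p \<le> n}"
  have fin: "finite ?S" by (rule finite_subset[of _ "{..n}"]) auto
  let ?\<phi> = "\<lambda>k::nat. (prime_factors (squarefree_part k), square_part k)"
  have sf: "\<Prod>(prime_factors (squarefree_part k)) = squarefree_part k" if "k > 0" for k :: nat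
  proof -
    have "squarefree (squarefree_part k)" by (rule squarefree_squarefree_part)
    then have "multiplicity p (squarefree_part k) = 1" if "p \<in> prime_factors (squarefree_part k)" for p
      using that by (metis not_squarefree_0 squarefree_factorial_semiring')
    then have "\<Prod>(prime_factors (squarefree_part k)) = (\<Prod>p\<in>prime_factors (squarefree_part k). p ^ multiplicity p (squarefree_part k))"
      by (intro prod.cong) auto
    also have "\<dots> = squarefree_part k" using that by (subst prod_prime_factors) auto
    finally show ?thesis .
  qed
  have dec: "k = \<Prod>(fst (?\<phi> k)) * (snd (?\<phi> k))\<^sup>2" if "k \<in> {1..n}" for k
    using sf[of k] that squarefree_decompose[of k] by simp
  have inj: "inj_on ?\<phi> {1..n}"
    using dec by (intro inj_onI) metis
  have img: "?\<phi> ` {1..n} \<subseteq> Pow ?S \<times> {1..n}"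
  proof (rule image_subsetI)
    fix k assume k: "k \<in> {1..n}"
    then have "squarefree_part k dvd k" "square_part k dvd k"
      using squarefree_decompose[of k] by (metis dvd_triv_left, metis dvd_triv_right dvd_mult dvd_power_same power2_eq_square dvd_mult_left)
    then have "squarefree_part k \<le> n" "square_part k \<le> n" "squarefree_part k > 0" "square_part k > 0"
      using k by (auto intro: order_trans[OF dvd_imp_le] gr0I)
    then show "?\<phi> k \<in> Pow ?S \<times> {1..n}"
      by (auto intro: order_trans[OF dvd_imp_le])
  qed
  have "ln (real n) \<le> ln (real n + 1)" using assms by simp
  also have "\<dots> \<le> (\<Sum>k = 1..n. 1 / real k)" by (rule ln_le_sum_inverse)
  also have "\<dots> = (\<Sum>k = 1..n. (\<lambda>(U, d). full_weight U * (1 / (real d)\<^sup>2)) (?\<phi> k))"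
  proof (rule sum.cong[OF refl])
    fix k assume k: "k \<in> {1..n}"
    have "real k = real (\<Prod>(fst (?\<phi> k)) * (snd (?\<phi> k))\<^sup>2)" using dec[OF k] by simp
    then show "1 / real k = (\<lambda>(U, d). full_weight U * (1 / (real d)\<^sup>2)) (?\<phi> k)"
      by (simp add: full_weight_eq)
  qed
  also have "\<dots> = (\<Sum>z\<in>?\<phi> ` {1..n}. (\<lambda>(U, d). full_weight U * (1 / (real d)\<^sup>2)) z)"
    using inj by (simp add: sum.reindex)
  also have "\<dots> \<le> (\<Sum>z\<in>Pow ?S \<times> {1..n}. (\<lambda>(U, d). full_weight U * (1 / (real d)\<^sup>2)) z)"
    using img fin by (intro sum_mono2) auto
  also have "\<dots> = (\<Sum>U\<in>Pow ?S. full_weight U) * (\<Sum>d = 1..n. 1 / (real d)\<^sup>2)"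
    by (simp add: sum_product sum.cartesian_product)
  also have "(\<Sum>U\<in>Pow ?S. full_weight U) = (\<Prod>p\<in>?S. 1 + 1 / real p)"
    unfolding full_weight_def using fin by (rule sum_Pow_prod)
  also have "(\<Prod>p\<in>?S. 1 + 1 / real p) * (\<Sum>d = 1..n. 1 / (real d)\<^sup>2) \<le> (\<Prod>p\<in>?S. 1 + 1 / real p) * 2"
    by (intro mult_left_mono sum_inverse_squares_le prod_nonneg) auto
  finally show ?thesis by simp
qed

section \<open>A graph on five vertices\<close>

text \<open>The graph on the vertices 0, ..., 4 with the edges 03, 04, 12, 13, 14, 23, 24, 34, numbered in
  this order. Deleting any one vertex leaves a connected graph that is not bipartite.\<close>
definition incident :: "nat \<Rightarrow> nat set" where
  "incident j = [{0, 1}, {2, 3, 4}, {2, 5, 6}, {0, 3, 5, 7}, {1, 4, 6, 7}] ! j"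

text \<open>Four edges, including those at \<open>j\<close>, whose labels serve as free coordinates.
  The other four labels are then determined by the four equations at the vertices other than
  \<open>j\<close>.\<close>

definition core :: "nat \<Rightarrow> nat set" where
  "core j = [{0, 1, 3, 5}, {2, 3, 4, 5}, {2, 3, 5, 6}, {0, 3, 5, 7}, {1, 4, 6, 7}] ! j"

lemma less_5_cases: "j < 5 \<longleftrightarrow> j = 0 \<or> j = 1 \<or> j = 2 \<or> j = 3 \<or> j = (4::nat)"
  by auto

lemma less_8_cases: "e < 8 \<longleftrightarrow> e = 0 \<or> e = 1 \<or> e = 2 \<or> e = 3 \<or> e = 4 \<or> e = 5 \<or> e = 6 \<or> e = (7::nat)"
  by auto

lemma incident_simps:
  "incident 0 = {0, 1}" "incident 1 = {2, 3, 4}" "incident 2 = {2, 5, 6}"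
  "incident 3 = {0, 3, 5, 7}" "incident 4 = {1, 4, 6, 7}"
  by (simp_all add: incident_def)

lemma core_simps:
  "core 0 = {0, 1, 3, 5}" "core 1 = {2, 3, 4, 5}" "core 2 = {2, 3, 5, 6}"
  "core 3 = {0, 3, 5, 7}" "core 4 = {1, 4, 6, 7}"
  by (simp_all add: core_def)

lemma incident_subset: "j < 5 \<Longrightarrow> incident j \<subseteq> {..<8}"
  by (auto simp: less_5_cases incident_simps simp del: One_nat_def)

lemma finite_incident [simp]: "j < 5 \<Longrightarrow> finite (incident j)"
  using incident_subset finite_subset by blast

lemma card_incident_le: "j < 5 \<Longrightarrow> card (incident j) \<le> 4"
  by (auto simp: less_5_cases incident_simps simp del: One_nat_def)

lemma card_core_diff_incident: "j < 5 \<Longrightarrow> card (core j - incident j) = 4 - card (incident j)"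
  by (auto simp: less_5_cases incident_simps core_simps insert_Diff_if simp del: One_nat_def)

lemma finite_core: "j < 5 \<Longrightarrow> finite (core j)"
  by (auto simp: less_5_cases core_simps simp del: One_nat_def)

text \<open>Every edge has two ends, so each edge prime occurs twice in the product of the five
  numbers; this makes the large primes contribute a square.\<close>

lemma prod_incident:
  fixes P :: "nat \<Rightarrow> 'a :: comm_monoid_mult"
  shows "(\<Prod>j<5. \<Prod>e\<in>incident j. P e) = (\<Prod>e<8. P e) * (\<Prod>e<8. P e)"
proof -
  have 5: "{..<5} = {0, 1, 2, 3, 4::nat}" and 8: "{..<8} = {0, 1, 2, 3, 4, 5, 6, 7::nat}" by auto
  show ?thesis unfolding 5 8 by (simp add: incident_simps ac_simps del: One_nat_def)
qed

text \<open>The edges outside \<open>core j\<close> connect the vertices other than \<open>j\<close> and contain exactly one cycle,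
  which is odd.\<close>
lemma eq_if_core_eq:
  fixes a a' :: "nat \<Rightarrow> nat"
  assumes "j < 5" "\<And>e. e \<in> core j \<Longrightarrow> a e = a' e" "\<And>i. i < 5 \<Longrightarrow> sum a (incident i) = sum a' (incident i)" "e < 8"
  shows "a e = a' e"
proof -
  have s: "a 0 + a 1 = a' 0 + a' 1" "a 2 + (a 3 + a 4) = a' 2 + (a' 3 + a' 4)"
    "a 2 + (a 5 + a 6) = a' 2 + (a' 5 + a' 6)" "a 0 + (a 3 + (a 5 + a 7)) = a' 0 + (a' 3 + (a' 5 + a' 7))"
    "a 1 + (a 4 + (a 6 + a 7)) = a' 1 + (a' 4 + (a' 6 + a' 7))"
    using assms(3)[of 0] assms(3)[of 1] assms(3)[of 2] assms(3)[of 3] assms(3)[of 4]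
    by (simp_all add: incident_simps del: One_nat_def)
  consider "j = 0" | "j = 1" | "j = 2" | "j = 3" | "j = 4" using assms(1) unfolding less_5_cases by blast
  then have "a 0 = a' 0 \<and> a 1 = a' 1 \<and> a 2 = a' 2 \<and> a 3 = a' 3 \<and> a 4 = a' 4 \<and> a 5 = a' 5 \<and> a 6 = a' 6 \<and> a 7 = a' 7"
  proof cases
    case 1
    then have "a 0 = a' 0" "a 1 = a' 1" "a 3 = a' 3" "a 5 = a' 5" using assms(2) by (auto simp: core_simps)
    then show ?thesis using s by linarith
  next
    case 2
    then have "a 2 = a' 2" "a 3 = a' 3" "a 4 = a' 4" "a 5 = a' 5"
      using assms(2) by (auto simp: core_simps simp del: One_nat_def)
    then show ?thesis using s by linarith
  next
    case 3
    then have "a 2 = a' 2" "a 3 = a' 3" "a 5 = a' 5" "a 6 = a' 6" using assms(2) by (auto simp: core_simps)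
    then show ?thesis using s by linarith
  next
    case 4
    then have "a 0 = a' 0" "a 3 = a' 3" "a 5 = a' 5" "a 7 = a' 7" using assms(2) by (auto simp: core_simps)
    then show ?thesis using s by linarith
  next
    case 5
    then have "a 1 = a' 1" "a 4 = a' 4" "a 6 = a' 6" "a 7 = a' 7" using assms(2) by (auto simp: core_simps)
    then show ?thesis using s by linarith
  qed
  then show ?thesis using assms(4) unfolding less_8_cases by metis
qed

text \<open>On a logarithmic scale, \<open>a e\<close> is the size of the prime on edge
  \<open>e\<close>, \<open>b j\<close> the size of the smooth part at vertex \<open>j\<close> and
  \<open>m\<close> the common target. The lower limit \<open>h\<close> will keep edge primes above
  the primes of the smooth parts.\<close>

definition admissible :: "nat \<Rightarrow> nat \<Rightarrow> (nat \<Rightarrow> nat) \<Rightarrow> (nat \<Rightarrow> nat) set" where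
  "admissible h m b = {a \<in> {..<8} \<rightarrow>\<^sub>E {h..m}. \<forall>j<5. sum a (incident j) + b j = m \<or> Suc (sum a (incident j) + b j) = m}"

lemma finite_admissible [simp]: "finite (admissible h m b)"
  unfolding admissible_def by (intro finite_Collect_conjI disjI1) (auto intro!: finite_PiE)

text \<open>Once the labels at \<open>j\<close> are fixed, a labelling is determined by the
  remaining labels on \<open>core j\<close> and by one bit per vertex telling which of its two
  allowed values the sum takes. The five bits give the factor 32.\<close>

lemma card_admissible_fibre_le:
  assumes j: "j < 5"
  shows "card {a \<in> admissible h m b. \<forall>e\<in>incident j. a e = c e} \<le> (m + 1) ^ (4 - card (incident j)) * 32"
    (is "card ?A \<le> _")
proof -
  let ?R = "core j - incident j"
  let ?\<phi> = "\<lambda>a. (restrict a ?R, \<lambda>i\<in>{..<5}. sum a (incident i) + b i = m)"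
  let ?B = "(?R \<rightarrow>\<^sub>E {..m}) \<times> ({..<5::nat} \<rightarrow>\<^sub>E (UNIV :: bool set))"
  have "inj_on ?\<phi> ?A"
  proof (rule inj_onI)
    fix a a' assume a: "a \<in> ?A" "a' \<in> ?A" "?\<phi> a = ?\<phi> a'"
    have c: "a e = a' e" if "e \<in> core j" for e
    proof (cases "e \<in> incident j")
      case False
      moreover have "fst (?\<phi> a) e = fst (?\<phi> a') e" by (rule arg_cong[OF a(3)])
      ultimately show ?thesis using that by simp
    qed (use a in auto)
    have s: "sum a (incident i) = sum a' (incident i)" if "i < 5" for i
    proof -
      have "snd (?\<phi> a) i = snd (?\<phi> a') i" by (rule arg_cong[OF a(3)])
      then have "(sum a (incident i) + b i = m) = (sum a' (incident i) + b i = m)"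
        using that by simp
      moreover have "sum a (incident i) + b i = m \<or> Suc (sum a (incident i) + b i) = m"
        "sum a' (incident i) + b i = m \<or> Suc (sum a' (incident i) + b i) = m"
        using a that by (auto simp: admissible_def)
      ultimately show ?thesis by linarith
    qed
    have "a \<in> {..<8} \<rightarrow>\<^sub>E {h..m}" "a' \<in> {..<8} \<rightarrow>\<^sub>E {h..m}" using a by (auto simp: admissible_def)
    then show "a = a'" by (rule PiE_ext) (use eq_if_core_eq[OF j c s] in auto)
  qed
  moreover have "?\<phi> ` ?A \<subseteq> ?B"
  proof (rule image_subsetI)
    fix a assume "a \<in> ?A"
    then have "a \<in> {..<8} \<rightarrow>\<^sub>E {h..m}" by (auto simp: admissible_def)
    moreover have "core j \<subseteq> {..<8}" using j by (auto simp: less_5_cases core_simps simp del: One_nat_def)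
    ultimately show "?\<phi> a \<in> ?B" by (auto simp: PiE_iff)
  qed
  moreover have "finite ?B" using finite_core[OF j] by (auto intro!: finite_PiE)
  ultimately have "card ?A \<le> card ?B" by (rule card_inj_on_le)
  also have "card ?B = (m + 1) ^ card ?R * 2 ^ 5"
    using finite_core[OF j] by (simp add: card_cartesian_product card_PiE)
  finally show ?thesis using card_core_diff_incident[OF j] by simp
qed

text \<open>The labels of the edges 3, 5, 7 are free; the cycle on the vertices 1, 2, 4 forces a
  division by 2, whose rounding error is the reason for allowing two values of each vertex sum.\<close>
lemma card_admissible_ge:
  assumes g: "1 \<le> g" and m: "1000 * g \<le> m" "m \<le> 1005 * g" and b: "\<And>j. j < 5 \<Longrightarrow> b j \<le> 10 * g"
  shows "g ^ 3 \<le> card (admissible (10 * g) m b)"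
proof -
  \<comment> \<open>The box is chosen so that the other labels come out near \<open>500 * g\<close>,
    \<open>500 * g\<close>, \<open>600 * g\<close>, \<open>200 * g\<close> and
    \<open>200 * g\<close>, well inside the permitted range despite the variation of
    \<open>m\<close> and \<open>b\<close>.\<close>
  let ?D = "{200*g..<201*g} \<times> {200*g..<201*g} \<times> {100*g..<101*g}"
  \<comment> \<open>Vertex 3 yields the label \<open>u\<close> of edge 0, then vertex 0 yields the
    label \<open>v\<close> of edge 1. What the triangle 1, 2, 4 has to contribute at vertices 4, 1,
    2 is \<open>p\<close>, \<open>q\<close>, \<open>r\<close>; each of its edge labels is half of an
    alternating sum of these.\<close>
  define \<phi> where "\<phi> = (\<lambda>(x, y, z).
    let u = m - b 3 - x - y - z; v = m - b 0 - u; p = m - b 4 - v - z; q = m - b 1 - x; r = m - b 2 - y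
    in restrict (\<lambda>e. [u, v, (q + r - p) div 2, x, (p + q - r) div 2, y, (p + r - q) div 2, z] ! e) {..<8})"
  have coords: "d = (\<phi> d 3, \<phi> d 5, \<phi> d 7)" for d
    by (cases d) (simp add: \<phi>_def Let_def)
  have inj: "inj_on \<phi> ?D" by (rule inj_onI) (metis coords)
  have img: "\<phi> ` ?D \<subseteq> admissible (10 * g) m b"
  proof (rule image_subsetI, clarify)
    fix x y z assume "x \<in> {200*g..<201*g}" "y \<in> {200*g..<201*g}" "z \<in> {100*g..<101*g}"
    then have xyz: "200*g \<le> x" "x \<le> 201*g" "200*g \<le> y" "y \<le> 201*g" "100*g \<le> z" "z \<le> 101*g" by auto
    define u where "u = m - b 3 - x - y - z"
    define v where "v = m - b 0 - u"
    define p where "p = m - b 4 - v - z"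
    define q where "q = m - b 1 - x"
    define r where "r = m - b 2 - y"
    define P where "P = (p + q - r) div 2"
    define Q where "Q = (p + r - q) div 2"
    define R where "R = (q + r - p) div 2"
    have b': "b 0 \<le> 10 * g" "b 1 \<le> 10 * g" "b 2 \<le> 10 * g" "b 3 \<le> 10 * g" "b 4 \<le> 10 * g"
      using b by auto
    have u: "u + b 3 + x + y + z = m" "487*g \<le> u" "u \<le> 505*g" using xyz b' m unfolding u_def by linarith+
    have v: "v + b 0 + u = m" "485*g \<le> v" "v \<le> 518*g" using u xyz b' m unfolding v_def by linarith+
    have p: "p + b 4 + v + z = m" "371*g \<le> p" "p \<le> 420*g" using v xyz b' m unfolding p_def by linarith+
    have q: "q + b 1 + x = m" "789*g \<le> q" "q \<le> 805*g" using xyz b' m unfolding q_def by linarith+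
    have r: "r + b 2 + y = m" "789*g \<le> r" "r \<le> 805*g" using xyz b' m unfolding r_def by linarith+
    have P: "2 * P + r = p + q \<or> 2 * P + 1 + r = p + q"
    proof -
      have "r \<le> p + q" using p q r by linarith
      then show ?thesis unfolding P_def by presburger
    qed
    have Q: "2 * Q + q = p + r \<or> 2 * Q + 1 + q = p + r"
    proof -
      have "q \<le> p + r" using p q r by linarith
      then show ?thesis unfolding Q_def by presburger
    qed
    have R: "2 * R + p = q + r \<or> 2 * R + 1 + p = q + r"
    proof -
      have "p \<le> q + r" using p q r by linarith
      then show ?thesis unfolding R_def by presburger
    qed
    have \<phi>: "\<phi> (x, y, z) = restrict (\<lambda>e. [u, v, R, x, P, y, Q, z] ! e) {..<8}"
      unfolding \<phi>_def Let_def u_def v_def p_def q_def r_def P_def Q_def R_def by simp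
    have vals: "\<phi> (x, y, z) 0 = u" "\<phi> (x, y, z) 1 = v" "\<phi> (x, y, z) 2 = R" "\<phi> (x, y, z) 3 = x"
      "\<phi> (x, y, z) 4 = P" "\<phi> (x, y, z) 5 = y" "\<phi> (x, y, z) 6 = Q" "\<phi> (x, y, z) 7 = z"
      unfolding \<phi> by simp_all
    have range: "\<phi> (x, y, z) e \<in> {10 * g..m}" if "e < 8" for e
    proof -
      have "u \<in> {10*g..m}" "v \<in> {10*g..m}" "x \<in> {10*g..m}" "y \<in> {10*g..m}" "z \<in> {10*g..m}"
        using u v xyz m g by auto
      moreover have "R \<in> {10*g..m}" "P \<in> {10*g..m}" "Q \<in> {10*g..m}"
        using p q r P Q R m g by auto
      ultimately show ?thesis using that unfolding less_8_cases by (elim disjE) (simp_all only: vals)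
    qed
    \<comment> \<open>Two halves rounded down lose at most 1 together, so each vertex sum is exact
      or one too small.\<close>
    have PQ: "P + Q \<le> p" "p \<le> Suc (P + Q)" using P Q by linarith+
    have PR: "P + R \<le> q" "q \<le> Suc (P + R)" using P R by linarith+
    have QR: "Q + R \<le> r" "r \<le> Suc (Q + R)" using Q R by linarith+
    have between: "k = l \<or> Suc k = l" if "k \<le> l" "l \<le> Suc k" for k l :: nat
      using that by auto
    have s: "sum (\<phi> (x, y, z)) (incident 0) = u + v" "sum (\<phi> (x, y, z)) (incident 1) = R + (x + P)"
      "sum (\<phi> (x, y, z)) (incident 2) = R + (y + Q)" "sum (\<phi> (x, y, z)) (incident 3) = u + (x + (y + z))"
      "sum (\<phi> (x, y, z)) (incident 4) = v + (P + (Q + z))"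
      by (simp_all add: incident_simps vals del: One_nat_def)
    have sums: "sum (\<phi> (x, y, z)) (incident j) + b j = m \<or> Suc (sum (\<phi> (x, y, z)) (incident j) + b j) = m"
      if "j < 5" for j
      using that unfolding less_5_cases
    proof (elim disjE)
      assume "j = 0" then show ?thesis using s v by (auto simp: ac_simps)
    next
      assume j: "j = 1" show ?thesis unfolding j s by (rule between) (use PR q(1) in linarith)+
    next
      assume j: "j = 2" show ?thesis unfolding j s by (rule between) (use QR r(1) in linarith)+
    next
      assume j: "j = 3" show ?thesis unfolding j s by (rule between) (use u(1) in linarith)+
    next
      assume j: "j = 4" show ?thesis unfolding j s by (rule between) (use PQ p(1) in linarith)+
    qed
    have "\<phi> (x, y, z) \<in> {..<8} \<rightarrow>\<^sub>E {10 * g..m}"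
      using range by (intro PiE_I) (auto simp: \<phi>)
    then show "\<phi> (x, y, z) \<in> admissible (10 * g) m b" using sums by (auto simp: admissible_def)
  qed
  have "g ^ 3 = card ?D" by (simp add: card_cartesian_product power3_eq_cube)
  also have "\<dots> \<le> card (admissible (10 * g) m b)" using inj img by (rule card_inj_on_le) simp
  finally show ?thesis .
qed

section \<open>Smooth parts\<close>

lemma sum_prod_3:
  fixes f :: "'a \<Rightarrow> real"
  shows "(\<Sum>(x, z, u)\<in>A \<times> C \<times> D. f x * h z * k u) = sum f A * sum h C * sum k D"
proof -
  have "(\<Sum>(x, z, u)\<in>A \<times> C \<times> D. f x * h z * k u) = (\<Sum>x\<in>A. \<Sum>z\<in>C. \<Sum>u\<in>D. f x * (h z * k u))"
    by (simp add: sum.cartesian_product mult.assoc)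
  also have "\<dots> = sum f A * (sum h C * sum k D)"
    by (simp flip: sum_distrib_left sum_distrib_right)
  finally show ?thesis by (simp add: mult.assoc)
qed

lemma sum_prod_4:
  fixes f :: "'a \<Rightarrow> real"
  shows "(\<Sum>(x, y, z, u)\<in>A \<times> B \<times> C \<times> D. f x * g y * h z * k u) = sum f A * sum g B * sum h C * sum k D"
proof -
  have "(\<Sum>(x, y, z, u)\<in>A \<times> B \<times> C \<times> D. f x * g y * h z * k u) = (\<Sum>x\<in>A. \<Sum>y\<in>B. \<Sum>z\<in>C. \<Sum>u\<in>D. f x * (g y * (h z * k u)))"
    by (simp add: sum.cartesian_product mult.assoc)
  also have "\<dots> = sum f A * (sum g B * (sum h C * sum k D))"
    by (simp flip: sum_distrib_left sum_distrib_right)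
  finally show ?thesis by (simp add: mult.assoc)
qed

type_synonym prime_sets = "nat set \<times> nat set \<times> nat set \<times> nat set"

fun smooth_part :: "prime_sets \<Rightarrow> nat \<Rightarrow> nat" where
  "smooth_part (X, Y, Z, U) j = [\<Prod>U, \<Prod>U, \<Prod>X * \<Prod>Y, \<Prod>Y * \<Prod>Z, \<Prod>Z * \<Prod>X] ! j"

fun smooth_weight :: "prime_sets \<Rightarrow> real" where
  "smooth_weight (X, Y, Z, U) = half_weight X * half_weight Y * half_weight Z * full_weight U"

definition prime_sets :: "nat \<Rightarrow> prime_sets set" where
  "prime_sets n = (let Q = Pow {p. prime p \<and> p \<le> n} in Q \<times> Q \<times> Q \<times> Q)"

lemma smooth_weight_nonneg: "0 \<le> smooth_weight t"
  by (cases t) simp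

lemma finite_primes_le [simp]: "finite {p::nat. prime p \<and> p \<le> n}"
  by (rule finite_subset[of _ "{..n}"]) auto

lemma finite_prime_sets [simp]: "finite (prime_sets n)"
  by (simp add: prime_sets_def Let_def)

definition total_weight :: "nat \<Rightarrow> real" where
  "total_weight n = sum smooth_weight (prime_sets n)"

context
  fixes n :: nat
  assumes n: "n \<ge> 2"
begin

private abbreviation (input) "S \<equiv> {p::nat. prime p \<and> p \<le> n}"
private abbreviation (input) "F \<equiv> sum half_weight (Pow S)"
private abbreviation (input) "G \<equiv> sum full_weight (Pow S)"

private lemma F_eq: "F = (\<Prod>p\<in>S. 1 + 1 / (2 * real p))"
  unfolding half_weight_def by (rule sum_Pow_prod) simp

private lemma G_eq: "G = (\<Prod>p\<in>S. 1 + 1 / real p)"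
  unfolding full_weight_def by (rule sum_Pow_prod) simp

private lemma F_ge_1: "F \<ge> 1"
  unfolding F_eq by (intro prod_ge_1) auto

private lemma G_ge: "G \<ge> ln (real n) / 2"
  unfolding G_eq using n by (intro prod_one_plus_inverse_primes_ge) auto

text \<open>Factor by factor, \<open>(1 + 1 / (2 * p)) ^ 2 \<ge> 1 + 1 / p\<close>. Thus fixing a
  pair of half-weighted sets saves at least as much as fixing the fully weighted one.\<close>

private lemma F_square_ge: "G \<le> F * F"
  unfolding F_eq G_eq prod.distrib [symmetric] by (intro prod_mono) (auto simp: algebra_simps)

private lemma total_weight_eq: "total_weight n = F * F * F * G"
proof -
  have "total_weight n = (\<Sum>(X, Y, Z, U)\<in>Pow S \<times> Pow S \<times> Pow S \<times> Pow S. half_weight X * half_weight Y * half_weight Z * full_weight U)"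
    unfolding total_weight_def prime_sets_def Let_def by (intro sum.cong) auto
  then show ?thesis by (simp only: sum_prod_4)
qed

private lemma ln_n_pos: "ln (real n) > 0"
  using n by simp

lemma total_weight_pos: "total_weight n > 0"
proof -
  have "F > 0" using F_ge_1 by linarith
  moreover have "G > 0" using G_ge ln_n_pos by linarith
  ultimately show ?thesis unfolding total_weight_eq by simp
qed

text \<open>Prescribing \<open>s\<close> constrains either \<open>U\<close> or one pair among
  \<open>X\<close>, \<open>Y\<close>, \<open>Z\<close>; these contribute at most
  \<open>1 / s\<close> instead of their full sum \<open>G\<close> or \<open>F * F\<close>, while the
  other sets remain free. Both full sums are at least \<open>ln n / 2\<close>.\<close>

lemma sum_smooth_weight_fibre_le:
  assumes j: "j < 5"
  shows "(\<Sum>t | t \<in> prime_sets n \<and> smooth_part t j = s. smooth_weight t) \<le> total_weight n * (2 / ln (real n)) / real s"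
    (is "?L \<le> _")
proof -
  let ?Q = "Pow S"
  let ?T = "{p. fst p \<in> ?Q \<and> snd p \<in> ?Q \<and> \<Prod>(fst p) * \<Prod>(snd p) = s}"
  let ?w = "\<lambda>p. half_weight (fst p) * half_weight (snd p)"
  have F: "F > 0" using F_ge_1 by linarith
  have G: "G > 0" using G_ge ln_n_pos by linarith
  have FG: "F * F * F \<le> total_weight n * (2 / ln (real n))"
  proof -
    have "1 \<le> G * (2 / ln (real n))" using G_ge ln_n_pos by (simp add: field_simps)
    then have "F * F * F * 1 \<le> F * F * F * (G * (2 / ln (real n)))" using F by (intro mult_left_mono) auto
    then show ?thesis by (simp only: total_weight_eq mult.assoc mult_1_right)
  qed
  have FG2: "F * G \<le> total_weight n * (2 / ln (real n))"
  proof -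
    have "F * G \<le> F * (F * F)" using F_square_ge F by (intro mult_left_mono) auto
    then show ?thesis using FG by (simp only: mult.assoc)
  qed
  have "sum ?w ?T = (\<Sum>(X, Y) | X \<in> ?Q \<and> Y \<in> ?Q \<and> \<Prod>X * \<Prod>Y = s. half_weight X * half_weight Y)"
    by (intro sum.cong) auto
  also have "\<dots> \<le> 1 / real s" by (rule sum_half_weight_fibre_le) auto
  finally have T: "sum ?w ?T \<le> 1 / real s" .
  have pair: "sum ?w ?T * F * G \<le> total_weight n * (2 / ln (real n)) / real s"
  proof -
    have "sum ?w ?T * F * G \<le> 1 / real s * F * G" using T F G by (intro mult_right_mono) auto
    also have "\<dots> = (F * G) / real s" by simp
    also have "\<dots> \<le> total_weight n * (2 / ln (real n)) / real s" using FG2 by (intro divide_right_mono) auto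
    finally show ?thesis .
  qed
  have single: "F * F * F * (\<Sum>U | U \<in> ?Q \<and> \<Prod>U = s. full_weight U) \<le> total_weight n * (2 / ln (real n)) / real s"
  proof -
    have "F * F * F * (\<Sum>U | U \<in> ?Q \<and> \<Prod>U = s. full_weight U) \<le> F * F * F * (1 / real s)"
      using F by (intro mult_left_mono sum_full_weight_fibre_le) auto
    also have "\<dots> = (F * F * F) / real s" by simp
    also have "\<dots> \<le> total_weight n * (2 / ln (real n)) / real s" using FG by (intro divide_right_mono) auto
    finally show ?thesis .
  qed
  consider "j = 0 \<or> j = 1" | "j = 2" | "j = 3" | "j = 4" using j unfolding less_5_cases by blast
  then show ?thesis
  proof cases
    case 1
    have "?L = (\<Sum>(X, Y, Z, U)\<in>?Q \<times> ?Q \<times> ?Q \<times> {U. U \<in> ?Q \<and> \<Prod>U = s}. half_weight X * half_weight Y * half_weight Z * full_weight U)"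
      using 1 by (intro sum.cong) (auto simp: prime_sets_def Let_def)
    with single show ?thesis by (simp only: sum_prod_4)
  next
    case 2
    have "?L = (\<Sum>(p, Z, U)\<in>?T \<times> ?Q \<times> ?Q. ?w p * half_weight Z * full_weight U)"
      using 2 by (intro sum.reindex_bij_witness[of _ "\<lambda>((X, Y), Z, U). (X, Y, Z, U)" "\<lambda>(X, Y, Z, U). ((X, Y), Z, U)"])
        (auto simp: prime_sets_def Let_def)
    with pair show ?thesis by (simp only: sum_prod_3)
  next
    case 3
    have "?L = (\<Sum>(p, Z, U)\<in>?T \<times> ?Q \<times> ?Q. ?w p * half_weight Z * full_weight U)"
      using 3 by (intro sum.reindex_bij_witness[of _ "\<lambda>((Y, Z), X, U). (X, Y, Z, U)" "\<lambda>(X, Y, Z, U). ((Y, Z), X, U)"])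
        (auto simp: prime_sets_def Let_def)
    with pair show ?thesis by (simp only: sum_prod_3)
  next
    case 4
    have "?L = (\<Sum>(p, Z, U)\<in>?T \<times> ?Q \<times> ?Q. ?w p * half_weight Z * full_weight U)"
      using 4 by (intro sum.reindex_bij_witness[of _ "\<lambda>((Z, X), Y, U). (X, Y, Z, U)" "\<lambda>(X, Y, Z, U). ((Z, X), Y, U)"])
        (auto simp: prime_sets_def Let_def)
    with pair show ?thesis by (simp only: sum_prod_3)
  qed
qed

text \<open>Markov's inequality for \<open>ln (\<Prod>X * \<Prod>Y * \<Prod>Z * \<Prod>U)\<close>, whose mean is at most \<open>5 * ln n\<close>.\<close>
lemma sum_smooth_weight_bounded_ge:
  assumes R: "10 * ln (real n) \<le> ln R" "R > 0"
  shows "total_weight n / 2 \<le> (\<Sum>t | t \<in> prime_sets n \<and> (\<forall>j<5. real (smooth_part t j) \<le> R). smooth_weight t)"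
proof -
  let ?Q = "Pow S"
  let ?G = "{t. t \<in> prime_sets n \<and> (\<forall>j<5. real (smooth_part t j) \<le> R)}"
  let ?l = "\<lambda>X. \<Sum>p\<in>X. ln (real p)"
  define L :: "prime_sets \<Rightarrow> real" where "L = (\<lambda>(X, Y, Z, U). ?l X + ?l Y + ?l Z + ?l U)"
  have F: "F > 0" using F_ge_1 by linarith
  have G: "G > 0" using G_ge ln_n_pos by linarith
  have lnpos: "0 \<le> ln (real p)" if "p \<in> S" for p using that prime_ge_1_nat[of p] by auto
  have lpos: "0 \<le> ?l X" if "X \<in> ?Q" for X using that lnpos by (intro sum_nonneg) auto
  have mert: "(\<Sum>p\<in>S. ln (real p) / real p) \<le> 2 * ln (real n)"
    using n by (intro sum_ln_div_prime_le) auto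
  have h: "(\<Sum>X\<in>?Q. half_weight X * ?l X) \<le> F * ln (real n)"
  proof -
    have "(\<Sum>X\<in>?Q. half_weight X * ?l X) \<le> (\<Prod>p\<in>S. 1 + 1 / (2 * real p)) * (\<Sum>p\<in>S. 1 / (2 * real p) * ln (real p))"
      unfolding half_weight_def using lnpos by (intro sum_Pow_prod_mult_sum_le) auto
    also have "(\<Sum>p\<in>S. 1 / (2 * real p) * ln (real p)) = (\<Sum>p\<in>S. ln (real p) / real p) / 2"
      by (simp add: sum_divide_distrib mult.commute)
    also have "(\<Prod>p\<in>S. 1 + 1 / (2 * real p)) * ((\<Sum>p\<in>S. ln (real p) / real p) / 2) \<le> F * ln (real n)"
      unfolding F_eq[symmetric] using mert F by (intro mult_left_mono) auto
    finally show ?thesis .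
  qed
  have f: "(\<Sum>X\<in>?Q. full_weight X * ?l X) \<le> G * (2 * ln (real n))"
  proof -
    have "(\<Sum>X\<in>?Q. full_weight X * ?l X) \<le> (\<Prod>p\<in>S. 1 + 1 / real p) * (\<Sum>p\<in>S. 1 / real p * ln (real p))"
      unfolding full_weight_def using lnpos by (intro sum_Pow_prod_mult_sum_le) auto
    also have "(\<Sum>p\<in>S. 1 / real p * ln (real p)) = (\<Sum>p\<in>S. ln (real p) / real p)" by simp
    also have "(\<Prod>p\<in>S. 1 + 1 / real p) * (\<Sum>p\<in>S. ln (real p) / real p) \<le> G * (2 * ln (real n))"
      unfolding G_eq[symmetric] using mert G by (intro mult_left_mono) auto
    finally show ?thesis .
  qed
  \<comment> \<open>The logarithm splits into four parts: the three half-weighted sets contribute at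
    most \<open>ln n\<close> each to the mean, and \<open>U\<close> at most
    \<open>2 * ln n\<close>.\<close>
  have "(\<Sum>t\<in>prime_sets n. smooth_weight t * L t)
    = (\<Sum>(X, Y, Z, U)\<in>?Q \<times> ?Q \<times> ?Q \<times> ?Q. (half_weight X * ?l X) * half_weight Y * half_weight Z * full_weight U)
    + (\<Sum>(X, Y, Z, U)\<in>?Q \<times> ?Q \<times> ?Q \<times> ?Q. half_weight X * (half_weight Y * ?l Y) * half_weight Z * full_weight U)
    + (\<Sum>(X, Y, Z, U)\<in>?Q \<times> ?Q \<times> ?Q \<times> ?Q. half_weight X * half_weight Y * (half_weight Z * ?l Z) * full_weight U)
    + (\<Sum>(X, Y, Z, U)\<in>?Q \<times> ?Q \<times> ?Q \<times> ?Q. half_weight X * half_weight Y * half_weight Z * (full_weight U * ?l U))"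
    unfolding sum.distrib[symmetric] prime_sets_def Let_def
    by (intro sum.cong refl) (auto simp: L_def algebra_simps)
  also have "\<dots> = (\<Sum>X\<in>?Q. half_weight X * ?l X) * F * F * G + F * (\<Sum>X\<in>?Q. half_weight X * ?l X) * F * G
      + F * F * (\<Sum>X\<in>?Q. half_weight X * ?l X) * G + F * F * F * (\<Sum>X\<in>?Q. full_weight X * ?l X)"
    by (simp only: sum_prod_4)
  also have "\<dots> \<le> (F * ln (real n)) * F * F * G + F * (F * ln (real n)) * F * G
      + F * F * (F * ln (real n)) * G + F * F * F * (G * (2 * ln (real n)))"
    using h f F G by (intro add_mono mult_right_mono mult_left_mono) auto
  also have "\<dots> = 5 * ln (real n) * total_weight n"
    by (simp add: total_weight_eq algebra_simps)
  finally have up: "(\<Sum>t\<in>prime_sets n. smooth_weight t * L t) \<le> 5 * ln (real n) * total_weight n" .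
  have L0: "0 \<le> L t" if "t \<in> prime_sets n" for t
    using that lpos by (auto simp: L_def prime_sets_def Let_def)
  \<comment> \<open>Each smooth part is a product over one or two of the four sets, so one that
    exceeds \<open>R\<close> already forces the logarithm of the whole product above
    \<open>ln R\<close>.\<close>
  have Lbad: "10 * ln (real n) \<le> L t" if t: "t \<in> prime_sets n - ?G" for t
  proof -
    obtain X Y Z U where XYZU: "t = (X, Y, Z, U)" "X \<in> ?Q" "Y \<in> ?Q" "Z \<in> ?Q" "U \<in> ?Q"
      using t by (cases t) (auto simp: prime_sets_def Let_def)
    have lp: "?l V = ln (real (\<Prod>V))" "\<Prod>V > 0" if "V \<in> ?Q" for V
    proof -
      have fin: "finite V" using that finite_subset[OF _ finite_primes_le[of n]] by auto
      have V: "v > 0" if "v \<in> V" for v using that \<open>V \<in> ?Q\<close> prime_gt_0_nat by blast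
      show "\<Prod>V > 0" using V by (intro prod_pos)
      have "ln (\<Prod>v\<in>V. real v) = ?l V" using V by (intro ln_prod fin) force
      then show "?l V = ln (real (\<Prod>V))" by simp
    qed
    obtain j where j: "j < 5" "real (smooth_part t j) > R" using t by force
    have pos: "\<Prod>X > 0" "\<Prod>Y > 0" "\<Prod>Z > 0" "\<Prod>U > 0" using lp XYZU by auto
    have "ln (real (smooth_part t j)) = ?l U \<or> ln (real (smooth_part t j)) = ?l X + ?l Y
      \<or> ln (real (smooth_part t j)) = ?l Y + ?l Z \<or> ln (real (smooth_part t j)) = ?l Z + ?l X"
    proof -
      have m: "ln (real (a * b)) = ln (real a) + ln (real b)" if "a > 0" "b > 0" for a b :: nat
        using that by (simp add: ln_mult)
      have "smooth_part t j = \<Prod>U \<or> smooth_part t j = \<Prod>X * \<Prod>Y \<or> smooth_part t j = \<Prod>Y * \<Prod>Z \<or> smooth_part t j = \<Prod>Z * \<Prod>X"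
        using j(1) unfolding less_5_cases XYZU(1) by (elim disjE) (simp_all only: smooth_part.simps, simp_all)
      then show ?thesis
        by (elim disjE) (simp_all only: lp(1)[OF XYZU(2)] lp(1)[OF XYZU(3)] lp(1)[OF XYZU(4)] lp(1)[OF XYZU(5)]
          m[OF pos(1,2)] m[OF pos(2,3)] m[OF pos(3,1)] simp_thms)
    qed
    then have "ln (real (smooth_part t j)) \<le> L t"
      unfolding XYZU(1) L_def using lpos[OF XYZU(2)] lpos[OF XYZU(3)] lpos[OF XYZU(4)] lpos[OF XYZU(5)] by auto
    moreover have "ln R \<le> ln (real (smooth_part t j))"
      using j(2) R(2) by (subst ln_le_cancel_iff) auto
    ultimately show ?thesis using R(1) by linarith
  qed
  have "10 * ln (real n) * sum smooth_weight (prime_sets n - ?G) = (\<Sum>t\<in>prime_sets n - ?G. smooth_weight t * (10 * ln (real n)))"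
    by (simp add: sum_distrib_left mult.commute)
  also have "\<dots> \<le> (\<Sum>t\<in>prime_sets n - ?G. smooth_weight t * L t)"
    using Lbad smooth_weight_nonneg by (intro sum_mono mult_left_mono)
  also have "\<dots> \<le> (\<Sum>t\<in>prime_sets n. smooth_weight t * L t)"
    using L0 smooth_weight_nonneg by (intro sum_mono2) auto
  also note up
  finally have *: "10 * ln (real n) * sum smooth_weight (prime_sets n - ?G) \<le> 5 * ln (real n) * total_weight n" .
  have "2 * y \<le> z" if "10 * x * y \<le> 5 * x * z" "x > 0" for x y z :: real
    using mult_left_le_imp_le[of "5 * x" "2 * y" z] that by (simp add: algebra_simps)
  from this[OF * ln_n_pos] have "2 * sum smooth_weight (prime_sets n - ?G) \<le> total_weight n" .
  moreover have "sum smooth_weight (prime_sets n - ?G) = total_weight n - sum smooth_weight ?G"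
    unfolding total_weight_def by (rule sum_diff) auto
  ultimately show ?thesis by simp
qed

end

section \<open>Configurations of five numbers\<close>

text \<open>One step of size \<open>base\<close> spans eight consecutive blocks, one for each edge
  of the graph.\<close>

definition base :: nat where "base = 32 ^ 8"

lemma base_gt_1: "base > 1" and base_pos [simp]: "base > 0"
  by (simp_all add: base_def)

lemma ln_base_ge_1: "1 \<le> ln (real base)"
proof -
  have "exp (1::real) \<le> 3" by (rule exp_le)
  also have "(3::real) \<le> real base" by (simp add: base_def)
  finally show ?thesis by (subst ln_ge_iff) (auto simp: base_def)
qed

text \<open>The floor of the logarithm to base \<open>base\<close>, for positive
  \<open>s\<close>.\<close>

definition level :: "nat \<Rightarrow> nat" where "level s = (LEAST b. s < base ^ (b + 1))"

lemma level:
  assumes "s > 0"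
  shows "base ^ level s \<le> s" "s < base ^ (level s + 1)"
proof -
  have "s < base ^ s" using base_gt_1 by (intro power_gt_expt) simp
  also have "\<dots> \<le> base ^ (s + 1)" using base_gt_1 by (intro power_increasing) auto
  finally show *: "s < base ^ (level s + 1)" unfolding level_def by (rule LeastI)
  show "base ^ level s \<le> s"
  proof (cases "level s")
    case (Suc b)
    then have "b < level s" by simp
    then have "\<not> s < base ^ (b + 1)" unfolding level_def by (rule not_less_Least)
    then show ?thesis using Suc by simp
  qed (use assms in simp)
qed

lemma level_le:
  assumes "s \<le> base ^ b"
  shows "level s \<le> b"
proof -
  have "base ^ b < base ^ (b + 1)" using base_gt_1 by (intro power_strict_increasing) auto
  then have "s < base ^ (b + 1)" using assms by linarith
  then show ?thesis unfolding level_def by (rule Least_le)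
qed

text \<open>Edge \<open>e\<close> draws its primes from blocks with index congruent to \<open>e\<close> modulo 8, so that a prime
  tells which edge it belongs to.\<close>
definition edge_primes :: "nat \<Rightarrow> nat \<Rightarrow> nat set" where
  "edge_primes e a = block_primes (8 * a + e)"

lemma block_primes_disjoint:
  assumes "p \<in> block_primes k" "p \<in> block_primes l"
  shows "k = l"
proof -
  have aux: "k \<le> l" if "p \<in> block_primes k" "p \<in> block_primes l" for k l
  proof (rule ccontr)
    assume "\<not> k \<le> l"
    then have "(32::nat) ^ (l + 1) \<le> 32 ^ k" by (intro power_increasing) auto
    then show False using that by (auto simp: block_primes_def)
  qed
  show ?thesis using aux[OF assms] aux[OF assms(2,1)] by simp
qed

lemma edge_primes_disjoint:
  assumes "p \<in> edge_primes e a" "p \<in> edge_primes e' a'" "e < 8" "e' < 8"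
  shows "e = e'" "a = a'"
proof -
  have *: "8 * a + e = 8 * a' + e'"
    using assms(1,2) unfolding edge_primes_def by (rule block_primes_disjoint)
  show "a = a'" using arg_cong[OF *, of "\<lambda>x. x div 8"] assms(3,4) by simp
  with * show "e = e'" by simp
qed

lemma edge_primesD:
  assumes "p \<in> edge_primes e a" "e < 8"
  shows "prime p" "base ^ a \<le> p" "p < base ^ (a + 1)"
proof -
  have p: "prime p" "32 ^ (8 * a + e) \<le> p" "p < 32 ^ (8 * a + e + 1)"
    using assms(1) by (auto simp: edge_primes_def block_primes_def)
  have "(32::nat) ^ (8 * a) \<le> 32 ^ (8 * a + e)" by (intro power_increasing) auto
  moreover have "(32::nat) ^ (8 * a + e + 1) \<le> 32 ^ (8 * (a + 1))" using assms(2) by (intro power_increasing) auto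
  ultimately show "prime p" "base ^ a \<le> p" "p < base ^ (a + 1)"
    using p unfolding base_def power_mult[symmetric] by linarith+
qed

lemma finite_edge_primes [simp]: "finite (edge_primes e a)"
  by (simp add: edge_primes_def)

lemma sum_edge_primes:
  assumes "a \<ge> 1" "e < 8"
  shows "(\<Sum>p\<in>edge_primes e a. 1 / real p) \<le> 1 / real a"
    and "1 / (320 * real a) \<le> (\<Sum>p\<in>edge_primes e a. 1 / real p)"
proof -
  have "(\<Sum>p\<in>edge_primes e a. 1 / real p) \<le> 2 / real (8 * a + e)"
    unfolding edge_primes_def using assms by (intro sum_inverse_block_primes_le) auto
  also have "\<dots> \<le> 1 / real a" using assms by (simp add: field_simps)
  finally show "(\<Sum>p\<in>edge_primes e a. 1 / real p) \<le> 1 / real a" .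
  \<comment> \<open>\<open>320 = 20 * 16\<close>, because
    \<open>8 * a + e + 1 \<le> 16 * a\<close>.\<close>
  have "1 / (320 * real a) \<le> 1 / (20 * real (8 * a + e + 1))"
    using assms by (intro divide_left_mono) auto
  also have "\<dots> \<le> (\<Sum>p\<in>edge_primes e a. 1 / real p)"
    unfolding edge_primes_def using assms by (intro sum_inverse_block_primes_ge) auto
  finally show "1 / (320 * real a) \<le> (\<Sum>p\<in>edge_primes e a. 1 / real p)" .
qed

lemma smooth_part_pos:
  assumes "t \<in> prime_sets n" "j < 5"
  shows "smooth_part t j > 0"
proof -
  obtain X Y Z U where t: "t = (X, Y, Z, U)" by (cases t)
  have "\<Prod>V > 0" if "V \<subseteq> {p. prime p \<and> p \<le> n}" for V :: "nat set"
    using that prime_gt_0_nat by (intro prod_pos) blast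
  then have "\<Prod>X > 0" "\<Prod>Y > 0" "\<Prod>Z > 0" "\<Prod>U > 0"
    using assms(1) unfolding t prime_sets_def Let_def by (simp_all only: mem_Times_iff fst_conv snd_conv Pow_iff)
  then show ?thesis using assms(2) unfolding t less_5_cases by (elim disjE) (simp_all del: prod_pos)
qed

lemma prime_dvd_smooth_part:
  assumes "t \<in> prime_sets n" "j < 5" "prime q" "q dvd smooth_part t j"
  shows "q \<le> n"
proof -
  obtain X Y Z U where t: "t = (X, Y, Z, U)" by (cases t)
  have *: "q \<le> n" if "V \<subseteq> {p. prime p \<and> p \<le> n}" "q dvd \<Prod>V" for V :: "nat set"
  proof -
    have "finite V" using that(1) finite_subset finite_primes_le by blast
    then have "q \<in> V" using prime_dvd_prod_primes_iff[of V q] that assms(3) by auto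
    then show ?thesis using that(1) by auto
  qed
  have sub: "X \<subseteq> {p. prime p \<and> p \<le> n}" "Y \<subseteq> {p. prime p \<and> p \<le> n}" "Z \<subseteq> {p. prime p \<and> p \<le> n}" "U \<subseteq> {p. prime p \<and> p \<le> n}"
    using assms(1) unfolding t prime_sets_def Let_def by simp_all
  have "q dvd \<Prod>X \<or> q dvd \<Prod>Y \<or> q dvd \<Prod>Z \<or> q dvd \<Prod>U"
    using assms(2,4) unfolding t less_5_cases by (elim disjE) (auto simp: prime_dvd_mult_iff[OF assms(3)])
  then show ?thesis using *[OF sub(1)] *[OF sub(2)] *[OF sub(3)] *[OF sub(4)] by blast
qed

lemma prod_smooth_part_square: "is_square (\<Prod>j<5. smooth_part t j)"
proof -
  obtain X Y Z U where t: "t = (X, Y, Z, U)" by (cases t)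
  have 5: "{..<5} = {0, 1, 2, 3, 4::nat}" by auto
  have "(\<Prod>j<5. smooth_part t j) = (\<Prod>X * \<Prod>Y * \<Prod>Z * \<Prod>U) ^ 2"
    unfolding 5 t by (simp add: power2_eq_square ac_simps)
  then show ?thesis by (metis is_nth_power_nth_power)
qed

type_synonym configuration = "prime_sets \<times> (nat \<Rightarrow> nat) \<times> (nat \<Rightarrow> nat)"

text \<open>The threshold is the tenth power of the smoothness bound \<open>base ^ g\<close>, as in
  the Markov estimate; it bounds all levels by \<open>10 * g\<close>, which leaves room for the edge
  labels.\<close>

definition small_sets :: "nat \<Rightarrow> prime_sets set" where
  "small_sets g = {t. t \<in> prime_sets (base ^ g) \<and> (\<forall>j<5. real (smooth_part t j) \<le> real (base ^ (10 * g)))}"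

text \<open>The primes determine the labels \<open>a\<close>; keeping \<open>a\<close> as a
  component turns the total weight into an iterated sum.\<close>

definition configurations :: "nat \<Rightarrow> nat \<Rightarrow> configuration set" where
  "configurations g m = (SIGMA t:small_sets g. SIGMA a:admissible (10 * g) m (\<lambda>j. level (smooth_part t j)).
     PiE {..<8} (\<lambda>e. edge_primes e (a e)))"

fun element :: "configuration \<Rightarrow> nat \<Rightarrow> nat" where
  "element (t, a, P) j = smooth_part t j * (\<Prod>e\<in>incident j. P e)"

fun weight :: "configuration \<Rightarrow> real" where
  "weight (t, a, P) = smooth_weight t * (\<Prod>e<8. 1 / real (P e))"

lemma weight_nonneg: "0 \<le> weight c"
  by (cases c) (auto intro!: mult_nonneg_nonneg smooth_weight_nonneg prod_nonneg)

lemma finite_small_sets [simp]: "finite (small_sets g)"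
  unfolding small_sets_def by (rule finite_subset[of _ "prime_sets (base ^ g)"]) auto

lemma finite_configurations [simp]: "finite (configurations g m)"
  unfolding configurations_def by (intro finite_SigmaI finite_PiE) auto

text \<open>Edge primes are chosen independently given \<open>a\<close>, so their sum factorizes
  over the edges. \<open>C\<close> is left general to cover also the fibres, in which some primes
  are prescribed.\<close>

lemma sum_Sigma_weight:
  assumes "finite A" "\<And>t. t \<in> A \<Longrightarrow> finite (B t)" "\<And>e a. finite (C e a)"
  shows "sum weight (SIGMA t:A. SIGMA a:B t. PiE {..<8} (\<lambda>e. C e a))
    = (\<Sum>t\<in>A. smooth_weight t * (\<Sum>a\<in>B t. \<Prod>e<8. \<Sum>p\<in>C e a. 1 / real p))"
proof -
  have fin: "finite (PiE {..<8::nat} (\<lambda>e. C e a))" for a using assms by (intro finite_PiE) auto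
  have "sum weight (SIGMA t:A. SIGMA a:B t. PiE {..<8} (\<lambda>e. C e a))
    = (\<Sum>t\<in>A. sum (\<lambda>z. weight (t, z)) (SIGMA a:B t. PiE {..<8} (\<lambda>e. C e a)))"
    using assms fin by (subst sum.Sigma) (auto intro!: finite_SigmaI sum.cong simp del: weight.simps)
  also have "\<dots> = (\<Sum>t\<in>A. \<Sum>a\<in>B t. \<Sum>P\<in>PiE {..<8} (\<lambda>e. C e a). weight (t, a, P))"
    using assms fin by (intro sum.cong refl, subst sum.Sigma) (auto intro!: sum.cong simp del: weight.simps)
  also have "\<dots> = (\<Sum>t\<in>A. smooth_weight t * (\<Sum>a\<in>B t. \<Prod>e<8. \<Sum>p\<in>C e a. 1 / real p))"
    using assms by (simp add: prod_sum_PiE sum_distrib_left)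
  finally show ?thesis .
qed

lemma prod_element_square: "is_square (\<Prod>j<5. element c j)"
proof -
  obtain t a P where c: "c = (t, a, P)" by (cases c)
  obtain r where r: "(\<Prod>j<5. smooth_part t j) = r ^ 2"
    using prod_smooth_part_square[of t] by (auto simp: is_nth_power_def)
  have "(\<Prod>j<5. element c j) = (r * (\<Prod>e<8. P e)) ^ 2"
    unfolding c by (simp add: prod.distrib r prod_incident power2_eq_square ac_simps)
  then show ?thesis by (metis is_nth_power_nth_power)
qed

section \<open>Size and distinctness of the five elements, total weight and fibre weights\<close>

context
  fixes g m :: nat
  assumes g: "1 \<le> g" and m: "1000 * g \<le> m" "m \<le> 1005 * g"
begin

lemma configurationsD:
  assumes "(t, a, P) \<in> configurations g m"
  shows "t \<in> prime_sets (base ^ g)" "t \<in> small_sets g" "a \<in> admissible (10 * g) m (\<lambda>j. level (smooth_part t j))"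
    "\<And>e. e < 8 \<Longrightarrow> P e \<in> edge_primes e (a e)" "P \<in> PiE {..<8} (\<lambda>e. edge_primes e (a e))"
    "\<And>e. e < 8 \<Longrightarrow> 10 * g \<le> a e" "\<And>e. e < 8 \<Longrightarrow> a e \<le> m"
proof -
  have *: "t \<in> small_sets g" "a \<in> admissible (10 * g) m (\<lambda>j. level (smooth_part t j))" "P \<in> PiE {..<8} (\<lambda>e. edge_primes e (a e))"
    using assms by (auto simp: configurations_def)
  then show "t \<in> small_sets g" "a \<in> admissible (10 * g) m (\<lambda>j. level (smooth_part t j))" "P \<in> PiE {..<8} (\<lambda>e. edge_primes e (a e))"
    by -
  show "t \<in> prime_sets (base ^ g)" using *(1) by (auto simp: small_sets_def)
  show "P e \<in> edge_primes e (a e)" if "e < 8" for e using *(3) that by (auto simp: PiE_iff)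
  have "a \<in> {..<8} \<rightarrow>\<^sub>E {10 * g..m}" using *(2) by (auto simp: admissible_def)
  then show "10 * g \<le> a e" "a e \<le> m" if "e < 8" for e using that by (auto simp: PiE_iff)
qed

text \<open>The sum of levels and labels is \<open>m\<close> or \<open>m - 1\<close>. Taking floors
  of logarithms hides less than one unit for the smooth part and for each of the at most four edge
  primes, five in all.\<close>

lemma element_bounds:
  assumes "c \<in> configurations g m" "j < 5"
  shows "base ^ (m - 1) \<le> element c j" "element c j < base ^ (m + 5)"
proof -
  obtain t a P where c: "c = (t, a, P)" by (cases c)
  note D = configurationsD[OF assms(1)[unfolded c]]
  let ?s = "smooth_part t j"
  have s: "base ^ level ?s \<le> ?s" "?s < base ^ (level ?s + 1)"
    using level smooth_part_pos[OF D(1) assms(2)] by auto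
  have P: "base ^ a e \<le> P e" "P e \<le> base ^ (a e + 1)" if "e \<in> incident j" for e
  proof -
    have e: "e < 8" using that incident_subset[OF assms(2)] by auto
    note edge_primesD[OF D(4)[OF e] e]
    then show "base ^ a e \<le> P e" "P e \<le> base ^ (a e + 1)" by simp_all
  qed
  have sum: "sum a (incident j) + level ?s = m \<or> Suc (sum a (incident j) + level ?s) = m"
    using D(3) assms(2) by (auto simp: admissible_def)
  have "base ^ (level ?s + sum a (incident j)) = base ^ level ?s * (\<Prod>e\<in>incident j. base ^ a e)"
    by (simp add: power_add power_sum)
  also have "\<dots> \<le> element c j"
    unfolding c element.simps using s P by (intro mult_mono prod_mono) auto
  finally have 1: "base ^ (level ?s + sum a (incident j)) \<le> element c j" .
  have "base ^ (m - 1) \<le> base ^ (level ?s + sum a (incident j))"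
    using sum base_gt_1 by (intro power_increasing) auto
  with 1 show "base ^ (m - 1) \<le> element c j" by linarith
  have "element c j \<le> ?s * (\<Prod>e\<in>incident j. base ^ (a e + 1))"
    unfolding c element.simps using P by (intro mult_left_mono prod_mono) auto
  also have "\<dots> < base ^ (level ?s + 1) * (\<Prod>e\<in>incident j. base ^ (a e + 1))"
    using s by (intro mult_strict_right_mono prod_pos) auto
  also have "\<dots> = base ^ (level ?s + 1 + (\<Sum>e\<in>incident j. a e + 1))"
    by (simp only: power_add power_sum)
  also have "\<dots> \<le> base ^ (m + 5)"
  proof (intro power_increasing)
    have "(\<Sum>e\<in>incident j. a e + 1) = sum a (incident j) + card (incident j)"
      by (simp only: sum.distrib card_eq_sum)
    then show "level ?s + 1 + (\<Sum>e\<in>incident j. a e + 1) \<le> m + 5"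
      using sum card_incident_le[OF assms(2)] by linarith
  qed (use base_gt_1 in auto)
  finally show "element c j < base ^ (m + 5)" .
qed

text \<open>Edge primes are at least \<open>base ^ (10 * g)\<close>, while smooth parts only have
  primes up to \<open>base ^ g\<close>.\<close>

lemma edge_prime_not_dvd_smooth_part:
  assumes "(t, a, P) \<in> configurations g m" "t' \<in> prime_sets (base ^ g)" "e < 8" "j < 5"
  shows "\<not> P e dvd smooth_part t' j"
proof
  assume d: "P e dvd smooth_part t' j"
  note D = configurationsD[OF assms(1)]
  note p = edge_primesD[OF D(4)[OF assms(3)] assms(3)]
  have "P e \<le> base ^ g" by (rule prime_dvd_smooth_part[OF assms(2,4) p(1) d])
  moreover have "base ^ g < base ^ a e" using D(6)[OF assms(3)] g base_gt_1 by (intro power_strict_increasing) auto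
  ultimately show False using p(2) by simp
qed

text \<open>The prime can only come from an edge of the second configuration, and the block
  containing it identifies the edge and the label.\<close>

lemma edge_prime_dvd_element:
  assumes "(t, a, P) \<in> configurations g m" "(t', a', P') \<in> configurations g m" "e < 8" "j < 5"
    and "P e dvd element (t', a', P') j"
  shows "e \<in> incident j" "P' e = P e" "a' e = a e"
proof -
  note D = configurationsD[OF assms(1)] and D' = configurationsD[OF assms(2)]
  note p = edge_primesD[OF D(4)[OF assms(3)] assms(3)]
  have "P e dvd (\<Prod>e\<in>incident j. P' e)"
    using assms(5) edge_prime_not_dvd_smooth_part[OF assms(1) D'(1) assms(3,4)] p(1)
    by (auto simp: prime_dvd_mult_iff)
  then obtain e' where e': "e' \<in> incident j" "P e dvd P' e'"
    using p(1) finite_incident[OF assms(4)] by (auto simp: prime_dvd_prod_iff)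
  then have e'8: "e' < 8" using incident_subset[OF assms(4)] by auto
  note p' = edge_primesD[OF D'(4)[OF e'8] e'8]
  have eq: "P e = P' e'" using e'(2) p(1) p'(1) by (simp add: primes_dvd_imp_eq)
  have "P e \<in> edge_primes e' (a' e')" using D'(4)[OF e'8] eq by simp
  from edge_primes_disjoint[OF D(4)[OF assms(3)] this assms(3) e'8]
  have "e = e'" "a e = a' e'" .
  then show "e \<in> incident j" "P' e = P e" "a' e = a e" using e' eq by auto
qed

text \<open>For distinct vertices \<open>i\<close> and \<open>j\<close> some edge meets
  \<open>i\<close> but not \<open>j\<close>; its prime divides exactly one of the two
  elements.\<close>

lemma element_inj:
  assumes "c \<in> configurations g m"
  shows "inj_on (element c) {..<5}"
proof (rule inj_onI, rule ccontr)
  fix i j assume ij: "i \<in> {..<5}" "j \<in> {..<5}" "element c i = element c j" "i \<noteq> j"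
  obtain t a P where c: "c = (t, a, P)" by (cases c)
  have "\<exists>e\<in>incident i. e \<notin> incident j"
    using ij(1,2,4) unfolding lessThan_iff less_5_cases
    by (elim disjE) (simp_all only: incident_simps, simp_all)
  then obtain e where e: "e \<in> incident i" "e \<notin> incident j" by blast
  have e8: "e < 8" using e(1) ij(1) incident_subset by auto
  have "P e dvd (\<Prod>e\<in>incident i. P e)" using e(1) ij(1) by (intro dvd_prodI) auto
  then have "P e dvd element (t, a, P) j" using ij(3) unfolding c by (metis dvd_mult element.simps)
  then show False
    using edge_prime_dvd_element(1)[of t a P t a P e j] assms c e8 ij(2) e(2) by auto
qed

text \<open>One element reveals its own edge primes, their labels and its smooth part. These are the
  constraints that describe a fibre.\<close>

lemma element_eqD:
  assumes "(t, a, P) \<in> configurations g m" "(t', a', P') \<in> configurations g m" "j < 5"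
    and "element (t, a, P) j = element (t', a', P') j"
  shows "\<And>e. e \<in> incident j \<Longrightarrow> P' e = P e" "\<And>e. e \<in> incident j \<Longrightarrow> a' e = a e" "smooth_part t' j = smooth_part t j"
proof -
  have *: "P' e = P e \<and> a' e = a e" if e: "e \<in> incident j" for e
  proof -
    have e8: "e < 8" using e assms(3) incident_subset by auto
    have "P e dvd (\<Prod>e\<in>incident j. P e)" using e assms(3) by (intro dvd_prodI) auto
    then have "P e dvd element (t', a', P') j" using assms(4) by (metis dvd_mult element.simps)
    then show ?thesis using edge_prime_dvd_element[OF assms(1,2) e8 assms(3)] by blast
  qed
  then show "\<And>e. e \<in> incident j \<Longrightarrow> P' e = P e" "\<And>e. e \<in> incident j \<Longrightarrow> a' e = a e" by blast+
  have "(\<Prod>e\<in>incident j. P' e) = (\<Prod>e\<in>incident j. P e)" using * by (intro prod.cong) auto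
  moreover have "(\<Prod>e\<in>incident j. P e) > 0"
  proof (rule prod_pos)
    fix e assume "e \<in> incident j"
    then have "e < 8" using assms(3) incident_subset by auto
    then show "0 < P e" using edge_primesD(1) configurationsD(4)[OF assms(1)] prime_gt_0_nat by blast
  qed
  ultimately show "smooth_part t' j = smooth_part t j" using assms(4) by simp
qed

lemma ln_base_power: "real g \<le> ln (real (base ^ g))"
  using mult_left_mono[OF ln_base_ge_1, of "real g"] by (simp add: ln_realpow)

lemma base_power_ge_2: "2 \<le> base ^ g"
  using base_gt_1 g self_le_power[of base g] by linarith

text \<open>Half of the smooth weight lies on \<open>small_sets g\<close>. Each such tuple admits at
  least \<open>g ^ 3\<close> labellings, and the eight edges contribute mass of order
  \<open>1 / g\<close> each, for a total of order \<open>g ^ 3 / g ^ 8\<close>.\<close>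

lemma sum_weight_configurations_ge:
  "total_weight (base ^ g) / 2 * ((1 / 321600) ^ 8 / real g ^ 5) \<le> sum weight (configurations g m)"
proof -
  let ?B = "\<lambda>t. admissible (10 * g) m (\<lambda>j. level (smooth_part t j))"
  \<comment> \<open>\<open>321600 = 320 * 1005\<close>, since labels are at most
    \<open>m \<le> 1005 * g\<close>.\<close>
  define K where "K = 1 / (321600 * real g)"
  have K: "K \<ge> 0" by (simp add: K_def)
  have in1: "real g ^ 3 * K ^ 8 \<le> (\<Sum>a\<in>?B t. \<Prod>e<8. \<Sum>p\<in>edge_primes e (a e). 1 / real p)" if t: "t \<in> small_sets g" for t
  proof -
    have "level (smooth_part t j) \<le> 10 * g" if "j < 5" for j
      using t that by (intro level_le) (auto simp: small_sets_def simp del: of_nat_power)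
    then have "g ^ 3 \<le> card (?B t)" using g m by (intro card_admissible_ge) auto
    then have "real g ^ 3 \<le> real (card (?B t))" by (metis of_nat_le_iff of_nat_power)
    then have "real g ^ 3 * K ^ 8 \<le> real (card (?B t)) * K ^ 8" using K by (intro mult_right_mono) auto
    also have "\<dots> = (\<Sum>a\<in>?B t. \<Prod>e<8::nat. K)" by simp
    also have "\<dots> \<le> (\<Sum>a\<in>?B t. \<Prod>e<8. \<Sum>p\<in>edge_primes e (a e). 1 / real p)"
    proof (intro sum_mono prod_mono conjI K)
      fix a e assume a: "a \<in> ?B t" and e: "e \<in> {..<8::nat}"
      then have ae: "10 * g \<le> a e" "a e \<le> m" by (auto simp: admissible_def PiE_iff)
      then have "real (a e) \<le> 1005 * real g" "a e \<ge> 1" using m g by auto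
      then have "K \<le> 1 / (320 * real (a e))" unfolding K_def by (intro divide_left_mono) (use g in auto)
      also have "\<dots> \<le> (\<Sum>p\<in>edge_primes e (a e). 1 / real p)" using \<open>a e \<ge> 1\<close> e by (intro sum_edge_primes(2)) auto
      finally show "K \<le> (\<Sum>p\<in>edge_primes e (a e). 1 / real p)" .
    qed
    finally show ?thesis .
  qed
  have "ln (real (base ^ (10 * g))) = 10 * ln (real (base ^ g))"
    by (simp add: ln_realpow)
  then have "total_weight (base ^ g) / 2 \<le> sum smooth_weight (small_sets g)"
    unfolding small_sets_def using base_power_ge_2 by (intro sum_smooth_weight_bounded_ge) (auto simp del: of_nat_power)
  then have "total_weight (base ^ g) / 2 * (real g ^ 3 * K ^ 8) \<le> sum smooth_weight (small_sets g) * (real g ^ 3 * K ^ 8)"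
    using K by (intro mult_right_mono) auto
  also have "\<dots> = (\<Sum>t\<in>small_sets g. smooth_weight t * (real g ^ 3 * K ^ 8))"
    by (simp add: sum_distrib_right)
  also have "\<dots> \<le> (\<Sum>t\<in>small_sets g. smooth_weight t * (\<Sum>a\<in>?B t. \<Prod>e<8. \<Sum>p\<in>edge_primes e (a e). 1 / real p))"
    using in1 smooth_weight_nonneg by (intro sum_mono mult_left_mono)
  also have "\<dots> = sum weight (configurations g m)"
    unfolding configurations_def by (rule sum_Sigma_weight[symmetric]) auto
  finally have "total_weight (base ^ g) / 2 * (real g ^ 3 * K ^ 8) \<le> sum weight (configurations g m)" .
  moreover have "real g ^ 3 * K ^ 8 = (1 / 321600) ^ 8 / real g ^ 5"
  proof -
    have "real g ^ 8 = real g ^ 3 * real g ^ 5" by (simp flip: power_add)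
    moreover have "K ^ 8 = (1 / 321600) ^ 8 / real g ^ 8"
      by (simp add: K_def power_divide power_mult_distrib)
    ultimately have "real g ^ 3 * K ^ 8 = real g ^ 3 * ((1 / 321600) ^ 8 / (real g ^ 3 * real g ^ 5))"
      by (simp only:)
    also have "\<dots> = (1 / 321600) ^ 8 / real g ^ 5"
    proof -
      have "x * (c / (x * y)) = c / y" if "x > 0" for x y c :: real using that by simp
      then show ?thesis using g by (simp only: of_nat_0_less_iff zero_less_power)
    qed
    finally show ?thesis .
  qed
  ultimately show ?thesis by simp
qed

text \<open>The power of \<open>g\<close> matches that of the total weight whatever the degree
  \<open>d\<close> of vertex \<open>j\<close>. The smooth part saves a factor of order
  \<open>g\<close>, at most order \<open>g ^ (4 - d)\<close> labellings remain, and the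
  \<open>8 - d\<close> free edges have mass at most \<open>1 / g\<close> each. The fixed edge primes
  and smooth part supply \<open>1 / v\<close>.\<close>

lemma sum_weight_fibre_le:
  assumes j: "j < 5"
  shows "(\<Sum>c | c \<in> configurations g m \<and> element c j = v. weight c)
    \<le> total_weight (base ^ g) * (64 * 1006 ^ 4) / real g ^ 5 / real v"
    (is "sum weight ?A \<le> _")
proof (cases "?A = {}")
  case True
  have "total_weight (base ^ g) \<ge> 0" using total_weight_pos[OF base_power_ge_2] by simp
  then show ?thesis unfolding True by simp
next
  case False
  then obtain t0 a0 P0 where 0: "(t0, a0, P0) \<in> configurations g m" "element (t0, a0, P0) j = v" by auto
  note D = configurationsD[OF 0(1)]
  define s where "s = smooth_part t0 j"
  define T where "T = {t. t \<in> prime_sets (base ^ g) \<and> smooth_part t j = s}"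
  define B where "B = (\<lambda>t. {a \<in> admissible (10 * g) m (\<lambda>j. level (smooth_part t j)). \<forall>e\<in>incident j. a e = a0 e})"
  \<comment> \<open>Any configuration in the fibre agrees with the reference one
    \<open>(t0, a0, P0)\<close> on the edges at \<open>j\<close>, so only the other edges keep a
    choice of primes.\<close>
  define C where "C = (\<lambda>e (a :: nat \<Rightarrow> nat). if e \<in> incident j then {P0 e} else edge_primes e (a e))"
  define d where "d = card (incident j)"
  have d: "d \<le> 4" unfolding d_def using j by (rule card_incident_le)
  define W where "W = (\<Prod>e\<in>incident j. 1 / real (P0 e))"
  have W: "W \<ge> 0" unfolding W_def by (intro prod_nonneg) auto
  have finB: "finite (B t)" for t unfolding B_def by (rule finite_subset[OF _ finite_admissible]) auto
  have finT: "finite T" unfolding T_def by (rule finite_subset[OF _ finite_prime_sets]) auto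
  have "?A \<subseteq> (SIGMA t:T. SIGMA a:B t. PiE {..<8} (\<lambda>e. C e a))"
  proof
    fix c assume c: "c \<in> ?A"
    obtain t a P where tc: "c = (t, a, P)" by (cases c)
    have c1: "(t, a, P) \<in> configurations g m" and c2: "element (t0, a0, P0) j = element (t, a, P) j"
      using c 0(2) tc by auto
    note D1 = configurationsD[OF c1] and E = element_eqD[OF 0(1) c1 j c2]
    have "t \<in> T" using D1(1) E(3) by (simp add: T_def s_def)
    moreover have "a \<in> B t" using D1(3) E(2) by (simp add: B_def)
    moreover have "P \<in> PiE {..<8} (\<lambda>e. C e a)"
      using D1(5) E(1) by (auto simp: PiE_iff C_def)
    ultimately show "c \<in> (SIGMA t:T. SIGMA a:B t. PiE {..<8} (\<lambda>e. C e a))" using tc by simp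
  qed
  then have "sum weight ?A \<le> sum weight (SIGMA t:T. SIGMA a:B t. PiE {..<8} (\<lambda>e. C e a))"
    using finT finB weight_nonneg
    by (intro sum_mono2 finite_SigmaI finite_PiE) (auto simp: C_def simp del: weight.simps)
  also have "\<dots> = (\<Sum>t\<in>T. smooth_weight t * (\<Sum>a\<in>B t. \<Prod>e<8. \<Sum>p\<in>C e a. 1 / real p))"
    using finT finB by (intro sum_Sigma_weight) (auto simp: C_def)
  also have "\<dots> \<le> (\<Sum>t\<in>T. smooth_weight t * (W * (32 * 1006 ^ 4 / real g ^ 4)))"
  proof (intro sum_mono mult_left_mono smooth_weight_nonneg)
    fix t assume "t \<in> T"
    have "(\<Sum>a\<in>B t. \<Prod>e<8. \<Sum>p\<in>C e a. 1 / real p) \<le> (\<Sum>a\<in>B t. W * (1 / real g) ^ (8 - d))"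
    proof (rule sum_mono)
      fix a assume a: "a \<in> B t"
      have "(\<Prod>e<8. \<Sum>p\<in>C e a. 1 / real p)
        = (\<Prod>e\<in>{..<8} - incident j. \<Sum>p\<in>C e a. 1 / real p) * (\<Prod>e\<in>incident j. \<Sum>p\<in>C e a. 1 / real p)"
        using incident_subset[OF j] by (intro prod.subset_diff) auto
      moreover have "(\<Prod>e\<in>incident j. \<Sum>p\<in>C e a. 1 / real p) = W"
        unfolding W_def by (intro prod.cong) (auto simp: C_def)
      moreover have "(\<Prod>e\<in>{..<8} - incident j. \<Sum>p\<in>C e a. 1 / real p) \<le> (\<Prod>e\<in>{..<8} - incident j. 1 / real g)"
      proof (intro prod_mono conjI sum_nonneg)
        fix e assume e: "e \<in> {..<8} - incident j"
        have "10 * g \<le> a e" using a e by (auto simp: B_def admissible_def PiE_iff)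
        then have ae: "a e \<ge> 1" "real g \<le> real (a e)" using g by auto
        have "(\<Sum>p\<in>C e a. 1 / real p) \<le> 1 / real (a e)"
          using e ae unfolding C_def by (simp add: sum_edge_primes(1))
        also have "\<dots> \<le> 1 / real g" using ae g by (intro divide_left_mono) auto
        finally show "(\<Sum>p\<in>C e a. 1 / real p) \<le> 1 / real g" .
      qed auto
      moreover have "(\<Prod>e\<in>{..<8} - incident j. 1 / real g) = (1 / real g) ^ (8 - d)"
        using incident_subset[OF j] by (simp add: d_def card_Diff_subset finite_incident[OF j])
      ultimately show "(\<Prod>e<8. \<Sum>p\<in>C e a. 1 / real p) \<le> W * (1 / real g) ^ (8 - d)"
        using W by (simp only: mult.commute[of _ W] mult_left_mono)
    qed
    also have "\<dots> = real (card (B t)) * (W * (1 / real g) ^ (8 - d))" by simp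
    also have "\<dots> \<le> real ((m + 1) ^ (4 - d) * 32) * (W * (1 / real g) ^ (8 - d))"
    proof (intro mult_right_mono)
      show "real (card (B t)) \<le> real ((m + 1) ^ (4 - d) * 32)"
        unfolding B_def d_def of_nat_le_iff by (rule card_admissible_fibre_le[OF j])
    qed (use W in auto)
    also have "\<dots> \<le> ((1006 * real g) ^ (4 - d) * 32) * (W * (1 / real g) ^ (8 - d))"
    proof (intro mult_right_mono)
      have "real (m + 1) ^ (4 - d) \<le> (1006 * real g) ^ (4 - d)"
        using m g by (intro power_mono) linarith+
      then show "real ((m + 1) ^ (4 - d) * 32) \<le> (1006 * real g) ^ (4 - d) * 32" by simp
    qed (use W in auto)
    also have "\<dots> = W * (32 * 1006 ^ (4 - d) * (real g ^ (4 - d) / real g ^ (8 - d)))"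
      by (simp add: power_mult_distrib power_divide)
    also have "real g ^ (4 - d) / real g ^ (8 - d) = 1 / real g ^ 4"
    proof -
      have "8 - d = (4 - d) + 4" using d by simp
      then have "real g ^ (8 - d) = real g ^ (4 - d) * real g ^ 4" by (simp only: power_add)
      moreover have "x / (x * y) = 1 / y" if "x > 0" for x y :: real using that by simp
      ultimately show ?thesis using g by simp
    qed
    also have "W * (32 * 1006 ^ (4 - d) * (1 / real g ^ 4)) \<le> W * (32 * 1006 ^ 4 * (1 / real g ^ 4))"
      using W by (intro mult_left_mono mult_right_mono power_increasing) auto
    finally show "(\<Sum>a\<in>B t. \<Prod>e<8. \<Sum>p\<in>C e a. 1 / real p) \<le> W * (32 * 1006 ^ 4 / real g ^ 4)" by simp
  qed
  also have "\<dots> = sum smooth_weight T * (W * (32 * 1006 ^ 4 / real g ^ 4))"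
    by (simp only: sum_distrib_right)
  also have "\<dots> \<le> total_weight (base ^ g) * (2 / real g) / real s * (W * (32 * 1006 ^ 4 / real g ^ 4))"
  proof (intro mult_right_mono)
    have "sum smooth_weight T \<le> total_weight (base ^ g) * (2 / ln (real (base ^ g))) / real s"
      unfolding T_def by (rule sum_smooth_weight_fibre_le[OF base_power_ge_2 j])
    also have "\<dots> \<le> total_weight (base ^ g) * (2 / real g) / real s"
    proof (intro divide_right_mono mult_left_mono frac_le)
      show "0 \<le> total_weight (base ^ g)" using total_weight_pos[OF base_power_ge_2] by simp
    qed (use ln_base_power g in auto)
    finally show "sum smooth_weight T \<le> total_weight (base ^ g) * (2 / real g) / real s" .
  qed (use W in auto)
  also have "\<dots> = total_weight (base ^ g) * (64 * 1006 ^ 4) / real g ^ 5 * (1 / real s * W)"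
  proof -
    have "real g ^ 5 = real g * real g ^ 4" by (simp add: eval_nat_numeral)
    then show ?thesis using g by (simp add: ac_simps)
  qed
  also have "1 / real s * W = 1 / real v"
    unfolding W_def 0(2)[symmetric] by (simp add: s_def prod_dividef)
  finally show ?thesis by simp
qed

end

section \<open>Dense sets\<close>

definition square_dense :: "nat \<Rightarrow> bool" where
  "square_dense k \<longleftrightarrow> (\<exists>\<delta>::real. \<delta> > 0 \<and> (\<exists>N0. \<forall>N\<ge>N0. \<forall>A\<subseteq>{1..N}.
     (1 - \<delta>) * real N \<le> real (card A) \<longrightarrow> \<not> square_product_free k A))"

text \<open>If \<open>A\<close> had no five elements with square product, every configuration would
  have an element in the complement \<open>B\<close>. The fibres over \<open>B\<close> would then
  carry all the weight, but \<open>B\<close> is too small for that.\<close>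

lemma square_dense_5: "square_dense 5"
proof -
  \<comment> \<open>\<open>K\<close> and \<open>\<kappa>\<close> come from the bounds on the fibres
    and on the total weight, and \<open>\<beta>\<close> bounds \<open>N / v\<close> for all elements
    \<open>v\<close>. The choice of \<open>\<delta>\<close> makes the fibres over \<open>B\<close>
    carry at most \<open>\<kappa> / 4\<close> in units in which the total is at least
    \<open>\<kappa> / 2\<close>.\<close>
  define K :: real where "K = 64 * 1006 ^ 4"
  define \<kappa> :: real where "\<kappa> = (1 / 321600) ^ 8"
  define \<beta> :: real where "\<beta> = real base ^ 7"
  define \<delta> where "\<delta> = \<kappa> / (20 * K * \<beta>)"
  have pos: "K > 0" "\<kappa> > 0" "\<beta> > 0" by (simp_all add: K_def \<kappa>_def \<beta>_def)
  then have \<delta>: "\<delta> > 0" by (simp add: \<delta>_def)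
  have "\<not> square_product_free 5 A"
    if N: "N \<ge> base ^ 200005" and A: "A \<subseteq> {1..N}" "(1 - \<delta>) * real N \<le> real (card A)" for N A
  proof
    assume free: "square_product_free 5 A"
    have "base ^ 200005 > 0" by simp
    then have N0: "N > 0" using N by linarith
    have "\<not> level N < 200005"
    proof
      assume "level N < 200005"
      then have "base ^ (level N + 1) \<le> base ^ 200005" using base_gt_1 by (intro power_increasing) auto
      then show False using level(2)[OF N0] N by linarith
    qed
    \<comment> \<open>With the shift by 5 the elements stay below
      \<open>base ^ level N \<le> N\<close>. The threshold on \<open>N\<close> ensures
      \<open>g \<ge> 200\<close>, hence \<open>m < 1000 * (g + 1) \<le> 1005 * g\<close>.\<close>
    define m where "m = level N - 5"
    have m: "level N = m + 5" "m \<ge> 200000"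
      using \<open>\<not> level N < 200005\<close> by (simp_all add: m_def)
    define g where "g = m div 1000"
    have "g \<ge> 200" using m(2) by (simp add: g_def)
    then have g: "1 \<le> g" "1000 * g \<le> m" "m \<le> 1005 * g" unfolding g_def by linarith+
    define B where "B = {1..N} - A"
    define w where "w = total_weight (base ^ g)"
    have w: "w > 0" unfolding w_def by (rule total_weight_pos[OF base_power_ge_2[OF g]])
    have finB: "finite B" by (simp add: B_def)
    have fin: "finite A" using A(1) finite_subset by auto
    have cB: "real (card B) \<le> \<delta> * real N"
    proof -
      have "card B = card {1..N} - card A" unfolding B_def using A(1) fin by (rule card_Diff_subset[rotated])
      moreover have "card A \<le> N" using card_mono[OF _ A(1)] by simp
      ultimately have "real (card B) = real N - real (card A)" by simp
      then show ?thesis using A(2) by (simp add: algebra_simps)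
    qed
    have hit: "\<exists>j<5. element c j \<in> B" if c: "c \<in> configurations g m" for c
    proof (rule ccontr)
      assume no: "\<not> ?thesis"
      have range: "element c j \<in> {1..N}" if "j < 5" for j
      proof -
        have "base ^ (m - 1) > 0" by simp
        then have "element c j \<ge> 1" using element_bounds(1)[OF g c that] by linarith
        moreover have "element c j \<le> N"
          using element_bounds(2)[OF g c that] level(1)[OF N0] m(1) by simp
        ultimately show ?thesis by simp
      qed
      have inj: "inj_on (element c) {..<5}" by (rule element_inj[OF g c])
      have "element c ` {..<5} \<subseteq> A" using no range by (auto simp: B_def)
      moreover have "card (element c ` {..<5}) = 5" using inj by (simp add: card_image)
      moreover have "is_square (\<Prod>(element c ` {..<5}))"
        using prod_element_square[of c] inj by (simp add: prod.reindex)
      ultimately show False using free unfolding square_product_free_def by blast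
    qed
    have fibre: "(\<Sum>c | c \<in> configurations g m \<and> element c j = v. weight c) \<le> w * K / real g ^ 5 * (\<beta> / real N)"
      if j: "j < 5" for j v
    proof (cases "{c. c \<in> configurations g m \<and> element c j = v} = {}")
      case True
      show ?thesis unfolding True using w pos by simp
    next
      case False
      then obtain c where c: "c \<in> configurations g m" "element c j = v" by auto
      have v: "base ^ (m - 1) \<le> v" using element_bounds(1)[OF g c(1) j] c(2) by simp
      have "N < base ^ (m + 6)" using level(2)[OF N0] m(1) by (simp add: add.commute)
      also have "base ^ (m + 6) = base ^ 7 * base ^ (m - 1)" proof -
        have "m + 6 = 7 + (m - 1)" using m(2) by simp
        then show ?thesis by (simp only: power_add)
      qed
      also have "\<dots> \<le> base ^ 7 * v" using v by (rule mult_le_mono2)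
      finally have "real N \<le> real (base ^ 7 * v)" by (subst of_nat_le_iff) simp
      then have Nv: "real N \<le> \<beta> * real v" by (simp add: \<beta>_def)
      have "v > 0" using v base_pos by (metis less_le_trans zero_less_power)
      then have "1 / real v \<le> \<beta> / real N" using Nv N0 by (simp add: field_simps)
      have "(\<Sum>c | c \<in> configurations g m \<and> element c j = v. weight c) \<le> w * K / real g ^ 5 / real v"
        unfolding w_def K_def by (rule sum_weight_fibre_le[OF g j])
      also have "\<dots> = w * K / real g ^ 5 * (1 / real v)" by simp
      also have "\<dots> \<le> w * K / real g ^ 5 * (\<beta> / real N)"
        using \<open>1 / real v \<le> \<beta> / real N\<close> w pos by (intro mult_left_mono) auto
      finally show ?thesis .
    qed
    have "w / 2 * (\<kappa> / real g ^ 5) \<le> sum weight (configurations g m)"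
      unfolding w_def \<kappa>_def by (rule sum_weight_configurations_ge[OF g])
    \<comment> \<open>Union bound over the vertex that falls into \<open>B\<close> and over its
      value.\<close>
    also have "\<dots> \<le> sum weight (\<Union>(j, v)\<in>{..<5} \<times> B. {c. c \<in> configurations g m \<and> element c j = v})"
    proof (rule sum_mono2[OF _ _ weight_nonneg])
      show "configurations g m \<subseteq> (\<Union>(j, v)\<in>{..<5} \<times> B. {c. c \<in> configurations g m \<and> element c j = v})"
      proof
        fix c assume c: "c \<in> configurations g m"
        then obtain j where "j < 5" "element c j \<in> B" using hit by blast
        with c show "c \<in> (\<Union>(j, v)\<in>{..<5} \<times> B. {c. c \<in> configurations g m \<and> element c j = v})"
          by (intro UN_I[of "(j, element c j)"]) (simp_all del: element.simps)
      qed
    qed (use finB in \<open>auto simp del: element.simps\<close>)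
    also have "\<dots> \<le> (\<Sum>z\<in>{..<5} \<times> B. sum weight (case z of (j, v) \<Rightarrow> {c. c \<in> configurations g m \<and> element c j = v}))"
      using finB weight_nonneg by (intro sum_UNION_le) auto
    also have "\<dots> \<le> (\<Sum>z\<in>{..<5::nat} \<times> B. w * K / real g ^ 5 * (\<beta> / real N))"
    proof (rule sum_mono)
      fix z :: "nat \<times> nat" assume "z \<in> {..<5} \<times> B"
      then obtain j v where z: "z = (j, v)" "j < 5" by (cases z) auto
      show "sum weight (case z of (j, v) \<Rightarrow> {c. c \<in> configurations g m \<and> element c j = v}) \<le> w * K / real g ^ 5 * (\<beta> / real N)"
        unfolding z(1) prod.case by (rule fibre[OF z(2)])
    qed
    also have "\<dots> = w / real g ^ 5 * (5 * K * \<beta> * (real (card B) / real N))"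
      by (simp add: card_cartesian_product ac_simps)
    also have "\<dots> \<le> w / real g ^ 5 * (5 * K * \<beta> * \<delta>)"
      using w pos cB N0 by (intro mult_left_mono) (auto simp: field_simps)
    also have "5 * K * \<beta> * \<delta> = \<kappa> / 4" using pos by (simp add: \<delta>_def)
    finally have "w / real g ^ 5 * (\<kappa> / 2) \<le> w / real g ^ 5 * (\<kappa> / 4)" by simp
    moreover have "w / real g ^ 5 > 0" using w g by simp
    ultimately have "\<kappa> / 2 \<le> \<kappa> / 4" by (simp only: mult_le_cancel_left_pos)
    then show False using pos by simp
  qed
  then show ?thesis unfolding square_dense_def using \<delta> by blast
qed

section \<open>Reduction of all \<open>k \<ge> 4\<close> to the cases 0 and 5\<close>

lemma square_dense_0: "square_dense 0"
proof -
  have "\<not> square_product_free 0 A" for A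
    unfolding square_product_free_def by (auto intro!: exI[of _ "{}"])
  then show ?thesis unfolding square_dense_def by (intro exI[of _ 1]) auto
qed

text \<open>A dense set contains some \<open>x\<close> together with \<open>4 * x\<close>, whose
  product is the square of \<open>2 * x\<close>. Removing both leaves a set still dense enough to
  supply \<open>k\<close> further elements.\<close>

lemma square_dense_add_2:
  assumes "square_dense k"
  shows "square_dense (k + 2)"
proof -
  obtain \<delta> :: real and N0 where \<delta>: "\<delta> > 0" and
    H: "\<And>N A. N \<ge> N0 \<Longrightarrow> A \<subseteq> {1..N} \<Longrightarrow> (1 - \<delta>) * real N \<le> real (card A) \<Longrightarrow> \<not> square_product_free k A"
    using assms unfolding square_dense_def by blast
  \<comment> \<open>\<open>\<delta> / 2\<close> leaves room for the two removed elements;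
    \<open>1 / 16\<close> forces a pair \<open>x\<close>, \<open>4 * x\<close>.\<close>
  define \<delta>' where "\<delta>' = min (\<delta> / 2) (1 / 16)"
  have \<delta>': "\<delta>' > 0" "\<delta>' \<le> \<delta> / 2" "\<delta>' \<le> 1 / 16" using \<delta> by (auto simp: \<delta>'_def)
  \<comment> \<open>From \<open>4 / \<delta>\<close> on, two elements are at most the fraction
    \<open>\<delta> / 2\<close> of \<open>N\<close>.\<close>
  define N1 where "N1 = max N0 (max 9 (nat \<lceil>4 / \<delta>\<rceil>))"
  have "\<not> square_product_free (k + 2) A"
    if N: "N \<ge> N1" and A: "A \<subseteq> {1..N}" "(1 - \<delta>') * real N \<le> real (card A)" for N A
  proof -
    have N': "N \<ge> N0" "N \<ge> 9" "4 / \<delta> \<le> real N" using N unfolding N1_def by linarith+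
    have fin: "finite A" using A(1) finite_subset by auto
    define B where "B = {1..N} - A"
    have finB: "finite B" by (simp add: B_def)
    have cB: "real (card B) \<le> \<delta>' * real N"
    proof -
      have "card B = card {1..N} - card A" unfolding B_def using A(1) fin by (rule card_Diff_subset[rotated])
      moreover have "card A \<le> N" using card_mono[OF _ A(1)] by simp
      ultimately have "real (card B) = real N - real (card A)" by simp
      then show ?thesis using A(2) by (simp add: algebra_simps)
    qed
    have "\<exists>x. x \<in> A \<and> 4 * x \<in> A"
    proof (rule ccontr)
      assume no: "\<not> ?thesis"
      \<comment> \<open>Without such a pair, each \<open>x \<le> N div 4\<close> has
        \<open>x\<close> or \<open>4 * x\<close> in \<open>B\<close>, so \<open>N div 4\<close> is
        at most twice the size of \<open>B\<close>, that is at most \<open>N / 8\<close>; this fails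
        for \<open>N \<ge> 9\<close>.\<close>
      have "{1..N div 4} \<subseteq> B \<union> {x. 4 * x \<in> B}" using no by (auto simp: B_def)
      moreover have inj: "inj_on ((*) 4) {x::nat. 4 * x \<in> B}" by (auto simp: inj_on_def)
      have fin4: "finite {x. 4 * x \<in> B}"
        by (rule finite_subset[of _ "{..N}"]) (auto simp: B_def)
      ultimately have "card {1..N div 4} \<le> card B + card {x. 4 * x \<in> B}"
        using finB by (intro order_trans[OF card_mono card_Un_le]) auto
      also have "card {x. 4 * x \<in> B} \<le> card B"
        using inj finB by (intro card_inj_on_le[of "(*) 4"]) auto
      finally have "real (N div 4) \<le> 2 * real (card B)" by simp
      also have "\<dots> \<le> 2 * (1 / 16 * real N)"
        using cB \<delta>'(3) mult_right_mono[OF \<delta>'(3), of "real N"] by simp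
      finally have "8 * (N div 4) \<le> N" by linarith
      then show False using N'(2) by presburger
    qed
    then obtain x where x: "x \<in> A" "4 * x \<in> A" by blast
    have x0: "x > 0" using x(1) A(1) by auto
    define A' where "A' = A - {x, 4 * x}"
    have A': "A' \<subseteq> {1..N}" using A(1) by (auto simp: A'_def)
    have "card A \<le> card A' + 2"
    proof -
      have "card A \<le> card (A' \<union> {x, 4 * x})" using fin by (intro card_mono) (auto simp: A'_def)
      also have "\<dots> \<le> card A' + card {x, 4 * x}" by (rule card_Un_le)
      also have "card {x, 4 * x} \<le> 2" by (simp add: card_insert_if)
      finally show ?thesis by simp
    qed
    moreover have "2 \<le> \<delta> / 2 * real N" using N'(3) \<delta> by (simp add: field_simps)
    moreover have "(1 - \<delta> / 2) * real N \<le> (1 - \<delta>') * real N" using \<delta>' by (intro mult_right_mono) auto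
    ultimately have "(1 - \<delta>) * real N \<le> real (card A')" using A(2) by (simp add: algebra_simps)
    from H[OF N'(1) A' this] obtain S where S: "S \<subseteq> A'" "finite S" "card S = k" "is_square (\<Prod>S)"
      unfolding square_product_free_def by blast
    have nin: "x \<notin> S" "4 * x \<notin> S" "x \<noteq> 4 * x" using S(1) x0 by (auto simp: A'_def)
    obtain r where r: "\<Prod>S = r ^ 2" using S(4) by (auto simp: is_nth_power_def)
    have "\<Prod>(insert x (insert (4 * x) S)) = (r * (2 * x)) ^ 2"
      using nin S(2) r by (simp add: power2_eq_square ac_simps)
    then have "is_square (\<Prod>(insert x (insert (4 * x) S)))" by (metis is_nth_power_nth_power)
    moreover have "card (insert x (insert (4 * x) S)) = k + 2" using nin S by simp
    moreover have "insert x (insert (4 * x) S) \<subseteq> A" using x S(1) by (auto simp: A'_def)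
    ultimately show ?thesis using S(2) unfolding square_product_free_def by (metis finite_insert)
  qed
  then show ?thesis unfolding square_dense_def using \<delta>'(1) by blast
qed

lemma square_dense_add_even: "square_dense k \<Longrightarrow> square_dense (k + 2 * i)"
  by (induction i) (auto dest: square_dense_add_2)

text \<open>Even \<open>k\<close> are reached from 0 and odd \<open>k\<close>, which are at least 5,
  from 5.\<close>

lemma square_dense_ge_4:
  assumes "k \<ge> 4"
  shows "square_dense k"
proof (cases "even k")
  case True
  then show ?thesis using square_dense_add_even[OF square_dense_0] by (auto elim!: evenE)
next
  case False
  then have "k = 5 + 2 * ((k - 5) div 2)" using assms by presburger
  then show ?thesis using square_dense_add_even[OF square_dense_5] by metis
qed

section \<open>From density to the error term and the limit superior\<close>

theorem theorem1p1:
  fixes k :: nat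
  assumes "k \<ge> 4"
  shows "(\<exists>c::real. c > 0 \<and> (\<exists>\<epsilon> :: nat \<Rightarrow> real. \<epsilon> \<longlonglongrightarrow> 0 \<and>
            (\<forall>N\<ge>1. real (max_square_product_free k N) \<le> (1 - c + \<epsilon> N) * real N)))
       \<and> limsup (\<lambda>N. ereal (real (max_square_product_free k N) / real N)) < 1"
proof -
  obtain \<delta> :: real and N0 where \<delta>: "\<delta> > 0" and
    H: "\<And>N A. N \<ge> N0 \<Longrightarrow> A \<subseteq> {1..N} \<Longrightarrow> (1 - \<delta>) * real N \<le> real (card A) \<Longrightarrow> \<not> square_product_free k A"
    using square_dense_ge_4[OF assms] unfolding square_dense_def by blast
  have k: "k > 0" using assms by simp
  have attained: "\<exists>A\<subseteq>{1..N}. square_product_free k A \<and> max_square_product_free k N = card A" for N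
    using Max_in[OF max_square_product_free_wf[OF k, of N]] unfolding max_square_product_free_def by auto
  have le: "real (max_square_product_free k N) \<le> real N" for N
  proof -
    obtain A where "A \<subseteq> {1..N}" "max_square_product_free k N = card A" using attained by blast
    then show ?thesis using card_mono[of "{1..N}" A] by simp
  qed
  have le': "real (max_square_product_free k N) \<le> (1 - \<delta>) * real N" if "N \<ge> N0" for N
  proof -
    obtain A where "A \<subseteq> {1..N}" "square_product_free k A" "max_square_product_free k N = card A"
      using attained by blast
    then show ?thesis using H[OF that, of A] by force
  qed
  \<comment> \<open>For the finitely many \<open>N < N0\<close> the error term restores the trivial
    bound \<open>N\<close>.\<close>
  define \<epsilon> where "\<epsilon> = (\<lambda>N. if N < N0 then \<delta> else 0)"
  have "\<forall>\<^sub>F N in sequentially. \<epsilon> N = 0"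
    using eventually_ge_at_top[of N0] by eventually_elim (simp add: \<epsilon>_def)
  then have "\<epsilon> \<longlonglongrightarrow> 0" by (rule tendsto_eventually)
  moreover have "\<forall>N\<ge>1. real (max_square_product_free k N) \<le> (1 - \<delta> + \<epsilon> N) * real N"
    using le le' by (auto simp: \<epsilon>_def)
  moreover have "limsup (\<lambda>N. ereal (real (max_square_product_free k N) / real N)) \<le> ereal (1 - \<delta>)"
  proof (rule Limsup_bounded)
    show "\<forall>\<^sub>F N in sequentially. ereal (real (max_square_product_free k N) / real N) \<le> ereal (1 - \<delta>)"
      using eventually_ge_at_top[of "max N0 1"]
    proof eventually_elim
      case (elim N)
      then show ?case using le'[of N] by (simp add: divide_le_eq)
    qed
  qed
  moreover have "ereal (1 - \<delta>) < 1" using \<delta> by simp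
  ultimately show ?thesis using \<delta> by (meson le_less_trans)
qed

end
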